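(* Let $1\le k\le n$. For a real symmetric $(n+1)\times(n+1)$ matrix $R=(r_{ij})_{0\le i,j\le n}$, write $r=(r_{ij})_{1\le i,j\le n}$, $x=(r_{01},\dots,r_{0n})$, and $$F_k(R)=r_{00}\,\sigma_k(r)-x\,T_{k-1}(r)\,x^T.$$ Let $\mathcal S=\{R: r\in\Gamma_k^+,\ F_k(R)>0\}$. Then $\mathcal S$ is a convex cone and $F_k^{1/(k+1)}$ is concave on $\mathcal S$; consequently $\log F_k$ is also concave on $\mathcal S$.
   Context: For a real symmetric $n\times n$ matrix $r$, $\sigma_j(r)$ is the $j$-th elementary symmetric function of its eigenvalues ($\sigma_0=1$), $\Gamma_k^+=\{r:\sigma_j(r)>0,\ 1\le j\le k\}$, and the Newton transformation is $T_{j}(r)=\sum_{i=0}^{j}(-1)^i\sigma_{j-i}(r)r^i$. *)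

theory Defs
  imports "HOL-Analysis.Analysis" "HOL-Computational_Algebra.Polynomial"
begin

definition charpoly :: "real^'n^'n \<Rightarrow> real poly" where
  "charpoly r = det (\<chi> i j. (if i = j then [:0, 1:] else 0) - [:r $ i $ j:])"

definition eigvals :: "real^'n^'n \<Rightarrow> ('n \<Rightarrow> real)" where
  "eigvals r = (SOME lam. charpoly r = (\<Prod>i\<in>UNIV. [:- lam i, 1:]))"

definition sigma :: "nat \<Rightarrow> real^'n^'n \<Rightarrow> real" where
  "sigma j r = (\<Sum>I\<in>{I. card I = j}. \<Prod>i\<in>I. eigvals r i)"

definition Gamma_plus :: "nat \<Rightarrow> (real^'n^'n) set" where
  "Gamma_plus k = {r. \<forall>j. 1 \<le> j \<and> j \<le> k \<longrightarrow> sigma j r > 0}"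

fun mpow :: "real^'n^'n \<Rightarrow> nat \<Rightarrow> real^'n^'n" where
  "mpow r 0 = mat 1"
| "mpow r (Suc i) = r ** mpow r i"

definition newton_T :: "nat \<Rightarrow> real^'n^'n \<Rightarrow> real^'n^'n" where
  "newton_T j r = (\<Sum>i\<in>{0..j}. ((-1) ^ i * sigma (j - i) r) *\<^sub>R mpow r i)"

text \<open>Blocks of an (n+1)x(n+1) matrix indexed by 'n option; None plays the role of index 0.\<close>
definition blk_r :: "real^('n::finite option)^('n option) \<Rightarrow> real^'n^'n" where
  "blk_r R = (\<chi> i j. R $ Some i $ Some j)"

definition blk_x :: "real^('n::finite option)^('n option) \<Rightarrow> real^'n" where
  "blk_x R = (\<chi> j. R $ None $ Some j)"

definition F :: "nat \<Rightarrow> real^('n::finite option)^('n option) \<Rightarrow> real" where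
  "F k R = R $ None $ None * sigma k (blk_r R) - blk_x R \<bullet> (newton_T (k - 1) (blk_r R) *v blk_x R)"

definition S_set :: "nat \<Rightarrow> (real^('n::finite option)^('n option)) set" where
  "S_set k = {R. transpose R = R \<and> blk_r R \<in> Gamma_plus k \<and> F k R > 0}"

end

theory Submission
  imports Defs "HOL-Computational_Algebra.Fundamental_Theorem_Algebra"
begin

text \<open>Since \<open>\<sigma>\<^sub>k\<close> is affine along rank-one lines with slope given by \<open>T\<^sub>k\<^sub>-\<^sub>1\<close>,
  one has \<open>F\<^sub>k(R) = r\<^sub>0\<^sub>0 \<sigma>\<^sub>k(r - x\<^sup>T x / r\<^sub>0\<^sub>0)\<close>, and \<open>S\<close> consists of the symmetric \<open>R\<close>
  with \<open>r\<^sub>0\<^sub>0 > 0\<close> whose Schur complement \<open>r - x\<^sup>T x / r\<^sub>0\<^sub>0\<close> lies in \<open>\<Gamma>\<^sub>k\<^sup>+\<close>. The Schur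
  complement of a sum exceeds the sum of the Schur complements by a positive semidefinite rank-one
  matrix, so everything reduces to Garding's theorem: \<open>\<Gamma>\<^sub>k\<^sup>+\<close> is a convex cone, \<open>\<sigma>\<^sub>k\<close> is increasing
  on it in positive semidefinite directions, and for \<open>A, B\<close> in it the polynomial \<open>\<sigma>\<^sub>k(A + s B)\<close> has
  only negative real roots \<open>- c\<^sub>i\<close>. The last fact turns the superadditivity of \<open>F\<^sub>k\<close> to the power
  \<open>1 / (k + 1)\<close> into Mahler's inequality for the numbers \<open>c\<^sub>i\<close>. It is proved by moving \<open>A\<close> to the
  identity matrix: during the motion no root can cross the boundary of a suitable half-plane.\<close>

section \<open>Polynomials\<close>

lemma coeff_mult_degree_le:
  fixes p q :: "'a::comm_semiring_0 poly"
  assumes "degree p \<le> m" and "degree q \<le> n"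
  shows "coeff (p * q) (m + n) = coeff p m * coeff q n"
proof -
  have "coeff p i * coeff q (m + n - i) = 0" if "i \<noteq> m" for i
    using that assms by (cases "i < m") (simp_all add: coeff_eq_0)
  then have "coeff (p * q) (m + n) = (\<Sum>i\<le>m + n. if i = m then coeff p m * coeff q n else 0)"
    unfolding coeff_mult by (intro sum.cong) auto
  then show ?thesis by simp
qed

lemma degree_coeff_prod_le:
  fixes f :: "'i \<Rightarrow> 'a::comm_semiring_1 poly"
  assumes "\<And>i. i \<in> I \<Longrightarrow> degree (f i) \<le> d i"
  shows "degree (\<Prod>i\<in>I. f i) \<le> (\<Sum>i\<in>I. d i) \<and>
    coeff (\<Prod>i\<in>I. f i) (\<Sum>i\<in>I. d i) = (\<Prod>i\<in>I. coeff (f i) (d i))"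
  using assms
proof (induction I rule: infinite_finite_induct)
  case (insert i I)
  then show ?case
    by (auto simp: coeff_mult_degree_le intro: order.trans[OF degree_mult_le] add_mono)
qed auto

lemma of_int_mult_poly: "of_int z * p = smult (of_int z) p" for p :: "'a::comm_ring_1 poly"
  by (simp add: of_int_poly)

lemma degree_coeff_det_le:
  fixes M :: "'a::comm_ring_1 poly^'n^'n"
  assumes "\<And>i j. degree (M $ i $ j) \<le> d i"
  shows "degree (det M) \<le> (\<Sum>i\<in>UNIV. d i)"
    and "coeff (det M) (\<Sum>i\<in>UNIV. d i) = det (\<chi> i j. coeff (M $ i $ j) (d i))"
proof -
  note row_prod = degree_coeff_prod_le[of UNIV "\<lambda>i. M $ i $ p i" d for p, OF assms]
  show "degree (det M) \<le> (\<Sum>i\<in>UNIV. d i)"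
    unfolding det_def of_int_mult_poly using row_prod
    by (intro degree_sum_le) (auto intro: order.trans[OF degree_smult_le])
  show "coeff (det M) (\<Sum>i\<in>UNIV. d i) = det (\<chi> i j. coeff (M $ i $ j) (d i))"
    unfolding det_def of_int_mult_poly coeff_sum coeff_smult using row_prod by simp
qed

lemma continuous_on_coeff_prod:
  fixes f :: "'i \<Rightarrow> 'b::topological_space \<Rightarrow> 'a::{comm_semiring_1,real_normed_algebra_1} poly"
  assumes "\<And>i m. continuous_on X (\<lambda>x. coeff (f i x) m)"
  shows "continuous_on X (\<lambda>x. coeff (\<Prod>i\<in>I. f i x) m)"
proof (induction I arbitrary: m rule: infinite_finite_induct)
  case (insert i I)
  then show ?case by (auto simp: coeff_mult intro!: continuous_intros assms)
qed auto

lemma poly_higher_pderiv_eq_coeff_pcompose: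
  fixes p :: "'a::{idom,ring_char_0} poly"
  shows "poly ((pderiv ^^ i) p) t = fact i * coeff (pcompose p [:t, 1:]) i"
proof -
  have "(pderiv ^^ i) (pcompose p [:t, 1:]) = pcompose ((pderiv ^^ i) p) [:t, 1:]" for i
    by (induction i) (simp_all add: pderiv_pcompose pderiv_pCons)
  then have "poly ((pderiv ^^ i) p) t = coeff ((pderiv ^^ i) (pcompose p [:t, 1:])) 0"
    by (simp add: poly_0_coeff_0[symmetric] poly_pcompose)
  also have "\<dots> = fact i * coeff (pcompose p [:t, 1:]) i"
    by (simp add: coeff_higher_pderiv pochhammer_fact)
  finally show ?thesis .
qed

lemma coeff_prod_linear_pos:
  fixes c :: "'i \<Rightarrow> 'a::linordered_idom"
  assumes "finite I" and "\<And>i. i \<in> I \<Longrightarrow> c i > 0" and "j \<le> card I"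
  shows "coeff (\<Prod>i\<in>I. [:c i, 1:]) j > 0"
proof -
  have "coeff (\<Prod>i\<in>I. [:c i, 1:]) j \<ge> 0 \<and> (j \<le> card I \<longrightarrow> coeff (\<Prod>i\<in>I. [:c i, 1:]) j > 0)" for j
    using assms(1,2)
  proof (induction I arbitrary: j rule: finite_induct)
    case (insert i I)
    let ?Q = "\<Prod>i\<in>I. [:c i, 1:]"
    have c_pos: "c i > 0" using insert.prems by simp
    have IH: "coeff ?Q j \<ge> 0" "j \<le> card I \<Longrightarrow> coeff ?Q j > 0" for j
      using insert by auto
    have prod_insert: "(\<Prod>i\<in>insert i I. [:c i, 1:]) = smult (c i) ?Q + pCons 0 ?Q"
      using insert.hyps by simp
    show ?case
    proof (cases j)
      case 0
      then show ?thesis using c_pos IH[of 0] by (simp add: prod_insert)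
    next
      case (Suc m)
      have "c i * coeff ?Q j \<ge> 0" using c_pos IH(1) by simp
      then show ?thesis
        using IH[of m] insert.hyps by (simp add: prod_insert Suc add_nonneg_pos)
    qed
  qed simp
  then show ?thesis using assms(3) by blast
qed

lemma poly_map_poly_of_real:
  "poly (map_poly of_real p) (of_real x) = (of_real (poly p x) :: 'a::{real_algebra_1,comm_ring_1})"
  by (induction p) (auto simp: map_poly_pCons)

lemma map_poly_of_real_eqI:
  fixes p :: "real poly" and P :: "'a::{real_algebra_1,idom} poly"
  assumes "\<And>x. poly P (of_real x) = of_real (poly p x)"
  shows "map_poly of_real p = P"
proof (rule ccontr)
  assume "map_poly of_real p \<noteq> P"
  then have "finite {x. poly (map_poly of_real p - P) x = 0}" by (intro poly_roots_finite) simp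
  moreover have "range of_real \<subseteq> {x. poly (map_poly of_real p - P) x = 0}"
    by (auto simp: assms poly_map_poly_of_real)
  ultimately have "finite (range (of_real :: real \<Rightarrow> 'a))" by (rule rev_finite_subset)
  then show False by (simp add: finite_image_iff inj_of_real infinite_UNIV_char_0)
qed

lemma image_mset_mset_setE:
  assumes "finite I" and "card I = size A"
  obtains f where "image_mset f (mset_set I) = A"
proof -
  obtain xs where A_eq: "A = mset xs" by (metis ex_mset)
  obtain g where g_bij: "bij_betw g I {0..<length xs}"
    using ex_bij_betw_finite_nat[OF assms(1)] assms(2) A_eq by auto
  have "image_mset (\<lambda>i. xs ! g i) (mset_set I) = image_mset ((!) xs) (image_mset g (mset_set I))"
    by (simp add: multiset.map_comp comp_def)
  also have "\<dots> = image_mset ((!) xs) (mset [0..<length xs])"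
    using g_bij by (simp add: bij_betw_def image_mset_mset_set)
  also have "\<dots> = A"
    unfolding A_eq mset_map[symmetric] by (simp add: map_nth)
  finally show ?thesis by (rule that)
qed

lemma alg_closed_factorizationE:
  fixes p :: "'a::alg_closed_field poly"
  assumes "p \<noteq> 0"
  obtains A where "size A = degree p" and "p = smult (lead_coeff p) (\<Prod>a\<in>#A. [:- a, 1:])"
    and "\<And>z. poly p z = lead_coeff p * (\<Prod>a\<in>#A. z - a)" and "\<And>a. a \<in># A \<Longrightarrow> poly p a = 0"
proof -
  obtain A where size: "size A = degree p" and factors: "p = smult (lead_coeff p) (\<Prod>a\<in>#A. [:- a, 1:])"
    using alg_closed_imp_factorization[OF assms] by blast
  have eval: "poly p z = lead_coeff p * (\<Prod>a\<in>#A. z - a)" for z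
    by (subst factors) (simp add: poly_prod_mset)
  then have "poly p a = 0" if "a \<in># A" for a
    using that by auto
  with size factors eval show ?thesis by (rule that)
qed

section \<open>Real-rooted polynomials\<close>

lemma poly_pderiv_prod_mset_linear:
  fixes A :: "'a::field multiset"
  assumes "z \<notin># A"
  shows "poly (pderiv (\<Prod>a\<in>#A. [:- a, 1:])) z = poly (\<Prod>a\<in>#A. [:- a, 1:]) z * (\<Sum>a\<in>#A. 1 / (z - a))"
  using assms
proof (induction A)
  case (add a A)
  let ?Q = "\<Prod>a\<in>#A. [:- a, 1:]"
  have "poly (pderiv ([:- a, 1:] * ?Q)) z = (z - a) * poly (pderiv ?Q) z + poly ?Q z"
    unfolding pderiv_mult poly_add poly_mult by (simp add: pderiv_pCons)
  moreover have "z - a \<noteq> 0" using add.prems by auto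
  ultimately show ?case using add by (simp add: distrib_left mult.assoc del: mult_pCons_left)
qed simp

text \<open>The Gauss--Lucas argument: every term of the logarithmic derivative has negative imaginary part.\<close>

lemma poly_pderiv_nonzero_upper_half_plane:
  fixes p :: "complex poly"
  assumes "degree p > 0" and no_root: "\<And>w. Im w > 0 \<Longrightarrow> poly p w \<noteq> 0"
    and Im_pos: "Im z > 0"
  shows "poly (pderiv p) z \<noteq> 0"
proof -
  have "p \<noteq> 0" using assms(1) by auto
  then obtain A where size: "size A = degree p" and factors: "p = smult (lead_coeff p) (\<Prod>a\<in>#A. [:- a, 1:])"
    and eval: "\<And>w. poly p w = lead_coeff p * (\<Prod>a\<in>#A. w - a)" and roots: "\<And>a. a \<in># A \<Longrightarrow> poly p a = 0"
    by (rule alg_closed_factorizationE) blast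
  have "Im a \<le> 0" if "a \<in># A" for a
    using roots[OF that] no_root[of a] by force
  moreover have "A \<noteq> {#}" using size assms(1) by auto
  ultimately have "Im (\<Sum>a\<in>#A. 1 / (z - a)) < 0"
  proof (induction A)
    case (add a A)
    have "Im (z - a) > 0" using add.prems(1)[of a] Im_pos by simp
    then have "Im (1 / (z - a)) < 0"
      by (simp add: Im_divide divide_neg_pos complex_eq_iff sum_power2_gt_zero_iff)
    moreover have "Im (\<Sum>a\<in>#A. 1 / (z - a)) \<le> 0"
      using add by (cases "A = {#}") (auto simp: less_imp_le)
    ultimately show ?case by simp
  qed simp
  moreover have "poly p z \<noteq> 0" by (rule no_root[OF Im_pos])
  moreover have "poly (pderiv p) z = poly p z * (\<Sum>a\<in>#A. 1 / (z - a))"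
  proof -
    have "z \<notin># A" using \<open>poly p z \<noteq> 0\<close> roots by blast
    from poly_pderiv_prod_mset_linear[OF this] show ?thesis
      by (subst factors) (simp add: pderiv_smult eval poly_prod_mset)
  qed
  ultimately show ?thesis by auto
qed

definition real_rooted :: "real poly \<Rightarrow> bool" where
  "real_rooted p \<longleftrightarrow> (\<forall>z. poly (map_poly complex_of_real p) z = 0 \<longrightarrow> Im z = 0)"

lemma real_rootedI:
  assumes "\<And>z. Im z > 0 \<Longrightarrow> poly (map_poly complex_of_real p) z \<noteq> 0"
  shows "real_rooted p"
  unfolding real_rooted_def
proof (intro allI impI)
  fix z assume root: "poly (map_poly complex_of_real p) z = 0"
  then have "poly (map_poly complex_of_real p) (cnj z) = 0"
    by (subst real_poly_cnj_root_iff) (auto simp: coeff_map_poly)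
  with root show "Im z = 0" using assms[of z] assms[of "cnj z"] by fastforce
qed

lemma real_rooted_pderiv:
  assumes "real_rooted p" and "degree p > 0"
  shows "real_rooted (pderiv p)"
proof (rule real_rootedI)
  let ?P = "map_poly complex_of_real p"
  have "map_poly complex_of_real (pderiv p) = pderiv ?P"
    by (intro poly_eqI) (simp add: coeff_map_poly coeff_pderiv)
  moreover have "degree ?P > 0" using assms(2) by (simp add: degree_map_poly)
  moreover have "poly ?P w \<noteq> 0" if "Im w > 0" for w
    using assms(1) that unfolding real_rooted_def by force
  ultimately show "poly (map_poly complex_of_real (pderiv p)) z \<noteq> 0" if "Im z > 0" for z
    using poly_pderiv_nonzero_upper_half_plane that by metis
qed

lemma real_rooted_higher_pderiv:
  assumes "real_rooted p" and "i \<le> degree p"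
  shows "real_rooted ((pderiv ^^ i) p)"
  using assms(2)
proof (induction i)
  case (Suc i)
  then show ?case by (simp add: real_rooted_pderiv degree_higher_pderiv)
qed (simp add: assms(1))

lemma real_rooted_factorization:
  assumes rooted: "real_rooted p" and index_set: "finite I" "card I = degree p"
  obtains c where "p = smult (lead_coeff p) (\<Prod>i\<in>I. [:- c i, 1:])"
proof -
  let ?P = "map_poly complex_of_real p"
  have "?P \<noteq> 0" using rooted[unfolded real_rooted_def, rule_format, of \<i>] by auto
  then obtain B where size: "size B = degree ?P"
    and eval: "\<And>z. poly ?P z = lead_coeff ?P * (\<Prod>b\<in>#B. z - b)"
    by (rule alg_closed_factorizationE) blast
  have "card I = size B" using size index_set(2) by (simp add: degree_map_poly)
  then obtain b where roots: "image_mset b (mset_set I) = B"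
    by (rule image_mset_mset_setE[OF index_set(1)])
  have poly_P: "poly ?P z = of_real (lead_coeff p) * (\<Prod>i\<in>I. z - b i)" for z
    by (simp add: eval coeff_map_poly degree_map_poly prod_unfold_prod_mset multiset.map_comp comp_def
        flip: roots)
  have "b i = of_real (Re (b i))" if "i \<in> I" for i
  proof -
    have "poly ?P (b i) = 0" using that index_set(1) by (auto simp: poly_P)
    then show ?thesis using rooted by (simp add: real_rooted_def complex_eq_iff)
  qed
  then have prod_real: "(\<Prod>i\<in>I. z - b i) = (\<Prod>i\<in>I. z - of_real (Re (b i)))" for z
    by (intro prod.cong) auto
  have "poly p x = poly (smult (lead_coeff p) (\<Prod>i\<in>I. [:- Re (b i), 1:])) x" for x
  proof -
    have "complex_of_real (poly p x) = poly ?P (of_real x)"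
      by (rule poly_map_poly_of_real[symmetric])
    also have "\<dots> = of_real (lead_coeff p * (\<Prod>i\<in>I. x - Re (b i)))"
      by (simp add: poly_P prod_real)
    finally show ?thesis unfolding of_real_eq_iff by (simp add: poly_prod)
  qed
  then show ?thesis by (intro that poly_eq_poly_eq_iff[THEN iffD1] ext)
qed

lemma real_rooted_coeff_pos:
  assumes rooted: "real_rooted p" and lead_pos: "lead_coeff p > 0"
    and roots_neg: "\<And>x. poly p x = 0 \<Longrightarrow> x < 0" and j_le_degree: "j \<le> degree p"
  shows "coeff p j > 0"
proof -
  obtain c where factors: "p = smult (lead_coeff p) (\<Prod>i<degree p. [:- c i, 1:])"
    using real_rooted_factorization[OF rooted, of "{..<degree p}"] by auto
  have "- c i > 0" if "i \<in> {..<degree p}" for i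
  proof -
    have "poly p (c i) = 0" by (subst factors) (use that in \<open>auto simp: poly_prod\<close>)
    then show ?thesis using roots_neg by simp
  qed
  then have "coeff (\<Prod>i<degree p. [:- c i, 1:]) j > 0"
    using j_le_degree by (intro coeff_prod_linear_pos) auto
  then show ?thesis using lead_pos by (subst factors) simp
qed

section \<open>Roots depending on a parameter\<close>

lemma norm_poly_root_le:
  fixes p :: "'a::real_normed_field poly"
  assumes "p \<noteq> 0" and root: "poly p z = 0"
  shows "norm z \<le> 1 + (\<Sum>i<degree p. norm (coeff p i)) / norm (lead_coeff p)"
proof (cases "norm z \<le> 1")
  case True
  then show ?thesis by (simp add: add_increasing2 sum_nonneg)
next
  case False
  have "degree p \<noteq> 0"
  proof
    assume "degree p = 0"
    then show False by (rule degree_eq_zeroE) (use assms in simp)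
  qed
  then obtain n where degree_p: "degree p = Suc n" by (metis not0_implies_Suc)
  have "(\<Sum>i<Suc n. coeff p i * z ^ i) + lead_coeff p * z ^ Suc n = 0"
    using root by (simp only: poly_altdef degree_p sum.atMost_Suc lessThan_Suc_atMost)
  then have "lead_coeff p * z ^ Suc n = - (\<Sum>i<Suc n. coeff p i * z ^ i)"
    by (rule minus_unique[symmetric])
  then have "norm (lead_coeff p * z ^ Suc n) = norm (\<Sum>i<Suc n. coeff p i * z ^ i)"
    by (simp only: norm_minus_cancel)
  also have "\<dots> \<le> (\<Sum>i<Suc n. norm (coeff p i) * norm z ^ n)"
  proof (rule sum_norm_le)
    fix i assume "i \<in> {..<Suc n}"
    then have "norm z ^ i \<le> norm z ^ n" using False by (intro power_increasing) auto
    then show "norm (coeff p i * z ^ i) \<le> norm (coeff p i) * norm z ^ n"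
      by (simp only: norm_mult norm_power mult_left_mono norm_ge_zero)
  qed
  also have "\<dots> = (\<Sum>i<Suc n. norm (coeff p i)) * norm z ^ n"
    by (rule sum_distrib_right[symmetric])
  finally have "norm (lead_coeff p) * norm z * norm z ^ n \<le> (\<Sum>i<Suc n. norm (coeff p i)) * norm z ^ n"
    by (simp only: norm_mult norm_power power_Suc mult.assoc)
  moreover have "norm z ^ n > 0" using False by (intro zero_less_power) linarith
  ultimately have "norm (lead_coeff p) * norm z \<le> (\<Sum>i<degree p. norm (coeff p i))"
    unfolding degree_p by (meson mult_le_cancel_right_pos)
  then have "norm z \<le> (\<Sum>i<degree p. norm (coeff p i)) / norm (lead_coeff p)"
    using assms(1) by (simp add: pos_le_divide_eq mult.commute)
  then show ?thesis by simp
qed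

lemma norm_poly_ge_if_no_root_in_ball:
  fixes p :: "complex poly"
  assumes "r > 0" and no_root: "\<And>w. w \<in> ball z r \<Longrightarrow> poly p w \<noteq> 0"
  shows "norm (lead_coeff p) * r ^ degree p \<le> norm (poly p z)"
proof -
  have "p \<noteq> 0" using no_root[of z] assms(1) by auto
  then obtain A where size: "size A = degree p"
    and eval: "poly p z = lead_coeff p * (\<Prod>a\<in>#A. z - a)" and roots: "\<And>a. a \<in># A \<Longrightarrow> poly p a = 0"
    by (rule alg_closed_factorizationE) blast
  have "r \<le> norm (z - a)" if "a \<in># A" for a
    using roots[OF that] no_root[of a] by (force simp: dist_norm)
  then have "r ^ size A \<le> norm (\<Prod>a\<in>#A. z - a)"
    using \<open>r > 0\<close> by (induction A) (auto simp: norm_mult intro!: mult_mono)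
  then show ?thesis by (simp add: eval size norm_mult mult_left_mono)
qed

lemma openin_parameters_with_root:
  fixes p :: "'s::topological_space \<Rightarrow> complex poly"
  assumes degree_p: "\<And>s. s \<in> S \<Longrightarrow> p s \<noteq> 0 \<and> degree (p s) = n"
    and continuous_coeff: "\<And>i. continuous_on S (\<lambda>s. coeff (p s) i)" and open_U: "open U"
  shows "openin (top_of_set S) {s \<in> S. \<exists>z\<in>U. poly (p s) z = 0}"
proof -
  define N where "N z r = S \<inter>
    (\<lambda>s. norm (\<Sum>i\<le>n. coeff (p s) i * z ^ i) - norm (coeff (p s) n) * r ^ n) -` {..<0}" for z and r :: real
  have mem_N_iff: "s \<in> N z r \<longleftrightarrow> s \<in> S \<and> norm (poly (p s) z) < norm (lead_coeff (p s)) * r ^ n" for s z r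
    using degree_p[of s] by (auto simp: N_def poly_altdef)
  have "{s \<in> S. \<exists>z\<in>U. poly (p s) z = 0} = (\<Union>(z, r)\<in>{(z, r). r > 0 \<and> ball z r \<subseteq> U}. N z r)"
  proof (intro equalityI subsetI)
    fix s assume "s \<in> {s \<in> S. \<exists>z\<in>U. poly (p s) z = 0}"
    then obtain z where root: "s \<in> S" "z \<in> U" "poly (p s) z = 0" by auto
    obtain r where "r > 0" "ball z r \<subseteq> U" using open_U root(2) by (metis open_contains_ball)
    then show "s \<in> (\<Union>(z, r)\<in>{(z, r). r > 0 \<and> ball z r \<subseteq> U}. N z r)"
      using root degree_p[OF root(1)] by (auto simp: mem_N_iff intro!: exI[of _ z] exI[of _ r])
  next
    fix s assume "s \<in> (\<Union>(z, r)\<in>{(z, r). r > 0 \<and> ball z r \<subseteq> U}. N z r)"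
    then obtain z r where ball: "r > 0" "ball z r \<subseteq> U" "s \<in> S"
      and "norm (poly (p s) z) < norm (lead_coeff (p s)) * r ^ n"
      by (auto simp: mem_N_iff)
    then have "\<exists>w\<in>ball z r. poly (p s) w = 0"
      using norm_poly_ge_if_no_root_in_ball[of r z "p s"] degree_p[of s] by force
    with ball show "s \<in> {s \<in> S. \<exists>z\<in>U. poly (p s) z = 0}" by blast
  qed
  moreover have "openin (top_of_set S) (N z r)" for z r
    unfolding N_def by (intro continuous_openin_preimage_gen continuous_intros continuous_coeff)
  ultimately show ?thesis by auto
qed

text \<open>No root comes in from infinity because the degree is constant.\<close>

lemma closedin_parameters_with_root:
  fixes p :: "'s::euclidean_space \<Rightarrow> complex poly"
  assumes compact_S: "compact S" and degree_p: "\<And>s. s \<in> S \<Longrightarrow> p s \<noteq> 0 \<and> degree (p s) = n"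
    and continuous_coeff: "\<And>i. continuous_on S (\<lambda>s. coeff (p s) i)" and closed_V: "closed V"
  shows "closedin (top_of_set S) {s \<in> S. \<exists>z\<in>V. poly (p s) z = 0}"
proof -
  define bound where "bound s = 1 + (\<Sum>i<n. norm (coeff (p s) i)) / norm (coeff (p s) n)" for s
  have "coeff (p s) n \<noteq> 0" if "s \<in> S" for s
    using degree_p[OF that] by (metis leading_coeff_0_iff)
  then have "compact (bound ` S)"
    unfolding bound_def
    by (intro compact_continuous_image compact_S continuous_intros continuous_coeff) auto
  then obtain B where "\<forall>s\<in>S. norm (bound s) \<le> B"
    by (meson compact_imp_bounded bounded_iff imageI)
  then have root_bound: "norm z \<le> B" if "s \<in> S" "poly (p s) z = 0" for s z
    using norm_poly_root_le[of "p s" z] degree_p[of s] that by (fastforce simp: bound_def)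
  let ?K = "V \<inter> cball 0 B"
  let ?Z = "(?K \<times> S) \<inter> (\<lambda>(z, s). \<Sum>i\<le>n. coeff (p s) i * z ^ i) -` {0}"
  have "closedin (top_of_set (?K \<times> S)) ?Z"
    unfolding case_prod_unfold
    by (intro continuous_closedin_preimage continuous_intros
        continuous_on_compose2[OF continuous_coeff]) auto
  then have "closedin (top_of_set S) {s. \<exists>z. z \<in> ?K \<and> (z, s) \<in> ?Z}"
    by (intro closedin_compact_projection closed_Int_compact closed_V compact_cball)
  moreover have "poly (p s) z = (\<Sum>i\<le>n. coeff (p s) i * z ^ i)" if "s \<in> S" for s z
    using degree_p[OF that] by (simp add: poly_altdef)
  then have "{s. \<exists>z. z \<in> ?K \<and> (z, s) \<in> ?Z} = {s \<in> S. \<exists>z\<in>V. poly (p s) z = 0}"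
    using root_bound by auto
  ultimately show ?thesis by simp
qed

lemma poly_roots_avoid_open_set:
  fixes p :: "'s::euclidean_space \<Rightarrow> complex poly"
  assumes compact_S: "compact S" and connected_S: "connected S"
    and degree_p: "\<And>s. s \<in> S \<Longrightarrow> p s \<noteq> 0 \<and> degree (p s) = n"
    and continuous_coeff: "\<And>i. continuous_on S (\<lambda>s. coeff (p s) i)"
    and open_U: "open U" and frontier_U: "\<And>s z. s \<in> S \<Longrightarrow> z \<in> frontier U \<Longrightarrow> poly (p s) z \<noteq> 0"
    and s0_in_S: "s0 \<in> S" and no_root_s0: "\<And>z. z \<in> U \<Longrightarrow> poly (p s0) z \<noteq> 0"
    and s_in_S: "s \<in> S" and z_in_U: "z \<in> U"
  shows "poly (p s) z \<noteq> 0"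
proof -
  let ?R = "{s \<in> S. \<exists>z\<in>U. poly (p s) z = 0}"
  have "?R = {s \<in> S. \<exists>z\<in>closure U. poly (p s) z = 0}"
    using frontier_U by (auto simp: closure_Un_frontier)
  then have "closedin (top_of_set S) ?R"
    using closedin_parameters_with_root[OF compact_S degree_p continuous_coeff closed_closure]
    by simp
  moreover have "openin (top_of_set S) ?R"
    by (rule openin_parameters_with_root[OF degree_p continuous_coeff open_U])
  ultimately have "?R = {} \<or> ?R = S" using connected_S by (meson connected_clopen)
  then show ?thesis using s0_in_S no_root_s0 s_in_S z_in_U by blast
qed

section \<open>Sums of principal minors\<close>

text \<open>Rows of the identity matrix keep the minor a determinant of full size.\<close>

definition principal_minor :: "'n set \<Rightarrow> 'a::comm_ring_1^'n^'n \<Rightarrow> 'a" where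
  "principal_minor I A = det (\<chi> i. if i \<in> I then A $ i else mat 1 $ i)"

definition minor_sum :: "nat \<Rightarrow> 'a::comm_ring_1^'n^'n \<Rightarrow> 'a" where
  "minor_sum k A = (\<Sum>I | card I = k. principal_minor I A)"

lemma principal_minor_eq_sum_permutations:
  fixes A :: "'a::comm_ring_1^'n^'n"
  shows "principal_minor I A = (\<Sum>p | p permutes UNIV.
    of_int (sign p) * ((\<Prod>i\<in>I. A $ i $ p i) * (\<Prod>i\<in>- I. of_bool (i = p i))))"
proof -
  have "(\<Prod>i\<in>UNIV. (if i \<in> I then A $ i else mat 1 $ i) $ p i) =
      (\<Prod>i\<in>I. A $ i $ p i) * (\<Prod>i\<in>- I. of_bool (i = p i))" for p
    by (simp add: if_distrib[of "\<lambda>v. v $ p _"] prod.If_cases mat_def of_bool_def cong: if_cong)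
  then show ?thesis by (simp add: principal_minor_def det_def)
qed

lemma det_add_mat:
  fixes A :: "'a::comm_ring_1^'n^'n"
  shows "det (A + mat t) = (\<Sum>k\<le>CARD('n). t ^ (CARD('n) - k) * minor_sum k A)"
proof -
  have prod_expand: "(\<Prod>i\<in>UNIV. (A + mat t) $ i $ p i) = (\<Sum>I\<in>UNIV. t ^ (CARD('n) - card I) *
      ((\<Prod>i\<in>I. A $ i $ p i) * (\<Prod>i\<in>- I. of_bool (i = p i))))" for p :: "'n \<Rightarrow> 'n"
  proof -
    have "(\<Prod>i\<in>UNIV. (A + mat t) $ i $ p i) = (\<Prod>i\<in>UNIV. A $ i $ p i + t * of_bool (i = p i))"
      by (intro prod.cong) (auto simp: mat_def)
    also have "\<dots> = (\<Sum>I\<in>UNIV. (\<Prod>i\<in>I. A $ i $ p i) * (\<Prod>i\<in>- I. t * of_bool (i = p i)))"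
      by (simp add: prod_add Compl_eq_Diff_UNIV)
    finally show ?thesis
      by (simp add: prod.distrib Compl_eq_Diff_UNIV card_Diff_subset mult_ac)
  qed
  have "det (A + mat t) = (\<Sum>I\<in>UNIV. t ^ (CARD('n) - card I) * principal_minor I A)"
    unfolding det_def prod_expand principal_minor_eq_sum_permutations sum_distrib_left
    by (subst sum.swap) (simp add: mult_ac)
  also have "\<dots> = (\<Sum>k\<le>CARD('n). \<Sum>I | I \<in> UNIV \<and> card I = k. t ^ (CARD('n) - card I) * principal_minor I A)"
    by (rule sum.group[symmetric]) (auto intro: card_mono)
  also have "\<dots> = (\<Sum>k\<le>CARD('n). t ^ (CARD('n) - k) * minor_sum k A)"
    by (simp add: minor_sum_def sum_distrib_left)
  finally show ?thesis .
qed

lemma minor_sum_0 [simp]: "minor_sum 0 A = 1" for A :: "'a::comm_ring_1^'n^'n"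
proof -
  have "{I :: 'n set. card I = 0} = {{}}" by auto
  then show ?thesis by (simp add: minor_sum_def principal_minor_def vec_nth_inverse)
qed

lemma minor_sum_card: "minor_sum CARD('n) A = det A" for A :: "'a::comm_ring_1^'n^'n"
proof -
  have "{I :: 'n set. card I = CARD('n)} = {UNIV}"
    by (auto dest: card_subset_eq[OF finite subset_UNIV])
  then show ?thesis by (simp add: minor_sum_def principal_minor_def vec_nth_inverse)
qed

lemma minor_sum_scale:
  fixes A :: "'a::comm_ring_1^'n^'n"
  shows "minor_sum k (\<chi> i j. c * A $ i $ j) = c ^ k * minor_sum k A"
proof -
  have "principal_minor I (\<chi> i j. c * A $ i $ j) = c ^ card I * principal_minor I A" for I :: "'n set"
    by (simp add: principal_minor_eq_sum_permutations prod.distrib sum_distrib_left mult_ac)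
  then show ?thesis by (simp add: minor_sum_def sum_distrib_left)
qed

lemma minor_sum_scaleR: "minor_sum k (c *\<^sub>R A) = c ^ k * minor_sum k A" for A :: "real^'n^'n"
proof -
  have "c *\<^sub>R A = (\<chi> i j. c * A $ i $ j)" by (simp add: vec_eq_iff)
  then show ?thesis by (simp add: minor_sum_scale)
qed

lemma minor_sum_diagonal:
  "minor_sum k (\<chi> i j. if i = j then d i else 0) = (\<Sum>I | card I = k. \<Prod>i\<in>I. d i)"
proof -
  have "principal_minor I (\<chi> i j. if i = j then d i else 0) = (\<Prod>i\<in>I. d i)" for I
  proof -
    have "principal_minor I (\<chi> i j. if i = j then d i else 0) = (\<Prod>i\<in>UNIV. if i \<in> I then d i else 1)"
      unfolding principal_minor_def by (subst det_diagonal) (auto simp: mat_def intro: prod.cong)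
    also have "\<dots> = (\<Prod>i\<in>I. d i)" by (simp add: prod.If_cases)
    finally show ?thesis .
  qed
  then show ?thesis by (simp add: minor_sum_def)
qed

lemma minor_sum_mat: "minor_sum k (mat t :: 'a::comm_ring_1^'n^'n) = of_nat (CARD('n) choose k) * t ^ k"
proof -
  have "minor_sum k (mat t :: 'a^'n^'n) = (\<Sum>I | I \<subseteq> (UNIV :: 'n set) \<and> card I = k. t ^ k)"
    unfolding mat_def minor_sum_diagonal by (intro sum.cong) auto
  then show ?thesis by (simp only: sum_constant n_subsets finite)
qed

lemma minor_sum_of_real:
  "minor_sum k (map_matrix of_real A) = (of_real (minor_sum k A) :: 'a::{real_algebra_1,comm_ring_1})"
  by (simp add: minor_sum_def principal_minor_eq_sum_permutations of_bool_def if_distrib[of of_real]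
      cong: if_cong)

lemma continuous_on_minor_sum:
  fixes A :: "'b::topological_space \<Rightarrow> 'a::{comm_ring_1,real_normed_algebra_1}^'n^'n"
  assumes "continuous_on X A"
  shows "continuous_on X (\<lambda>x. minor_sum k (A x))"
  unfolding minor_sum_def principal_minor_eq_sum_permutations
  by (intro continuous_intros assms)

section \<open>Pencils of matrices\<close>

definition minor_pencil :: "nat \<Rightarrow> 'a::comm_ring_1^'n^'n \<Rightarrow> 'a^'n^'n \<Rightarrow> 'a poly" where
  "minor_pencil k A B = minor_sum k (\<chi> i j. [:A $ i $ j, B $ i $ j:])"

lemma poly_minor_pencil: "poly (minor_pencil k A B) s = minor_sum k (\<chi> i j. A $ i $ j + s * B $ i $ j)"
  by (simp add: minor_pencil_def minor_sum_def principal_minor_eq_sum_permutations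
      poly_sum poly_prod of_bool_def if_distrib[of "\<lambda>p. poly p _"] cong: if_cong)

lemma poly_minor_pencil_real: "poly (minor_pencil k A B) s = minor_sum k (A + s *\<^sub>R B)"
  for A B :: "real^'n^'n"
proof -
  have "(\<chi> i j. A $ i $ j + s * B $ i $ j) = A + s *\<^sub>R B" by (simp add: vec_eq_iff)
  then show ?thesis by (simp add: poly_minor_pencil)
qed

lemma poly_minor_pencil_mat_1: "poly (minor_pencil k A (mat 1)) t = minor_sum k (A + mat t)"
proof -
  have "(\<chi> i j. A $ i $ j + t * mat 1 $ i $ j) = A + mat t"
    by (simp add: mat_def vec_eq_iff)
  then show ?thesis by (simp add: poly_minor_pencil)
qed

lemma minor_pencil_swap:
  fixes A B :: "'a::field^'n^'n"
  assumes "s \<noteq> 0"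
  shows "poly (minor_pencil k A B) s = s ^ k * poly (minor_pencil k B A) (1 / s)"
  unfolding poly_minor_pencil minor_sum_scale[symmetric] using assms
  by (simp add: distrib_left add.commute)

lemma map_poly_minor_pencil:
  "map_poly of_real (minor_pencil k A B) =
    (minor_pencil k (map_matrix of_real A) (map_matrix of_real B) :: 'a::{real_algebra_1,idom} poly)"
proof (rule map_poly_of_real_eqI)
  fix x
  have "(\<chi> i j. of_real (A $ i $ j) + of_real x * of_real (B $ i $ j)) =
      (map_matrix of_real (\<chi> i j. A $ i $ j + x * B $ i $ j) :: 'a^_^_)"
    by (simp add: vec_eq_iff)
  then show "poly (minor_pencil k (map_matrix of_real A) (map_matrix of_real B)) (of_real x) =
      (of_real (poly (minor_pencil k A B) x) :: 'a)"
    by (simp add: poly_minor_pencil minor_sum_of_real)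
qed

lemma degree_minor_pencil_le: "degree (minor_pencil k A B) \<le> k"
  and coeff_minor_pencil_top: "coeff (minor_pencil k A B) k = minor_sum k B"
  for A B :: "'a::comm_ring_1^'n^'n"
proof -
  define M where "M I = (\<chi> i. if i \<in> I then \<chi> j. [:A $ i $ j, B $ i $ j:] else mat 1 $ i)" for I :: "'n set"
  have pencil_eq: "minor_pencil k A B = (\<Sum>I | card I = k. det (M I))"
    by (simp add: minor_pencil_def minor_sum_def principal_minor_def M_def cong: if_cong)
  have "degree (M I $ i $ j) \<le> of_bool (i \<in> I)" for I i j
    by (simp add: M_def mat_def)
  note row_degrees = degree_coeff_det_le[of "M I" "\<lambda>i. of_bool (i \<in> I)" for I, OF this]
  have degree_det: "degree (det (M I)) \<le> card I" for I
    using row_degrees(1)[of I] by simp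
  then show "degree (minor_pencil k A B) \<le> k"
    unfolding pencil_eq by (intro degree_sum_le) auto
  have "(\<chi> i j. coeff (M I $ i $ j) (of_bool (i \<in> I))) = (\<chi> i. if i \<in> I then B $ i else mat 1 $ i)" for I
    by (simp add: M_def mat_def vec_eq_iff)
  then have "coeff (det (M I)) (card I) = principal_minor I B" for I
    using row_degrees(2)[of I] by (simp add: principal_minor_def)
  then show "coeff (minor_pencil k A B) k = minor_sum k B"
    unfolding pencil_eq coeff_sum minor_sum_def by (intro sum.cong) auto
qed

lemma degree_minor_pencil:
  assumes "minor_sum k B \<noteq> 0"
  shows "degree (minor_pencil k A B) = k"
  using assms
  by (intro antisym[OF degree_minor_pencil_le le_degree]) (simp add: coeff_minor_pencil_top)

lemma minor_pencil_nonzero: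
  assumes "minor_sum k B \<noteq> 0"
  shows "minor_pencil k A B \<noteq> 0"
  using assms by (metis coeff_0 coeff_minor_pencil_top)

lemma continuous_on_coeff_minor_pencil:
  fixes A B :: "'b::topological_space \<Rightarrow> 'a::{comm_ring_1,real_normed_algebra_1}^'n^'n"
  assumes "continuous_on X A" and "continuous_on X B"
  shows "continuous_on X (\<lambda>x. coeff (minor_pencil k (A x) (B x)) m)"
proof -
  have entry: "continuous_on X (\<lambda>x. coeff [:A x $ i $ j, B x $ i $ j:] m)" for i j m
    by (cases m; cases "m - 1") (auto simp: coeff_pCons intro!: continuous_intros assms)
  show ?thesis
    unfolding minor_pencil_def minor_sum_def principal_minor_eq_sum_permutations of_int_mult_poly
    by (simp add: coeff_sum coeff_mult continuous_intros continuous_on_coeff_prod entry)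
qed

lemma minor_pencil_card_mat_1:
  fixes A :: "'a::{idom,ring_char_0}^'n^'n"
  shows "minor_pencil CARD('n) A (mat 1) = (\<Sum>k\<le>CARD('n). monom (minor_sum k A) (CARD('n) - k))"
proof -
  have "poly (minor_pencil CARD('n) A (mat 1)) t =
      poly (\<Sum>k\<le>CARD('n). monom (minor_sum k A) (CARD('n) - k)) t" for t
    by (simp add: poly_minor_pencil_mat_1 minor_sum_card det_add_mat poly_sum poly_monom mult.commute)
  then show ?thesis by (intro poly_eq_poly_eq_iff[THEN iffD1] ext)
qed

lemma coeff_minor_pencil_card_mat_1:
  fixes A :: "'a::{idom,ring_char_0}^'n^'n"
  assumes "k \<le> CARD('n)"
  shows "coeff (minor_pencil CARD('n) A (mat 1)) (CARD('n) - k) = minor_sum k A"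
proof -
  have "coeff (minor_pencil CARD('n) A (mat 1)) (CARD('n) - k) =
      (\<Sum>j\<le>CARD('n). if j = k then minor_sum k A else 0)"
    unfolding minor_pencil_card_mat_1 coeff_sum using assms by (intro sum.cong) auto
  then show ?thesis using assms by simp
qed

lemma higher_pderiv_minor_pencil_mat_1:
  fixes A :: "'a::{idom,ring_char_0}^'n^'n"
  assumes "k \<le> CARD('n)"
  shows "(pderiv ^^ (CARD('n) - k)) (minor_pencil CARD('n) A (mat 1)) =
    smult (fact (CARD('n) - k)) (minor_pencil k A (mat 1))"
proof -
  let ?p = "\<lambda>A. minor_pencil CARD('n) A (mat 1)"
  have shift: "pcompose (?p A) [:t, 1:] = ?p (A + mat t)" for t
  proof -
    have "mat t + mat x = (mat (t + x) :: 'a^'n^'n)" for x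
      by (simp add: mat_def vec_eq_iff)
    then have "poly (pcompose (?p A) [:t, 1:]) x = poly (?p (A + mat t)) x" for x
      by (simp add: poly_pcompose poly_minor_pencil_mat_1 add.assoc)
    then show ?thesis by (intro poly_eq_poly_eq_iff[THEN iffD1] ext)
  qed
  have "poly ((pderiv ^^ (CARD('n) - k)) (?p A)) t =
      poly (smult (fact (CARD('n) - k)) (minor_pencil k A (mat 1))) t" for t
    using assms by (simp add: poly_higher_pderiv_eq_coeff_pcompose shift
        coeff_minor_pencil_card_mat_1 poly_minor_pencil_mat_1)
  then show ?thesis by (intro poly_eq_poly_eq_iff[THEN iffD1] ext)
qed

lemma coeff_minor_pencil_mat_1:
  fixes A :: "'a::field_char_0^'n^'n"
  assumes "j \<le> k" and "k \<le> CARD('n)"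
  shows "coeff (minor_pencil k A (mat 1)) (k - j) = of_nat (CARD('n) - j choose (k - j)) * minor_sum j A"
proof -
  have "fact (CARD('n) - k) * coeff (minor_pencil k A (mat 1)) (k - j) =
      coeff ((pderiv ^^ (CARD('n) - k)) (minor_pencil CARD('n) A (mat 1))) (k - j)"
    unfolding higher_pderiv_minor_pencil_mat_1[OF assms(2)] by simp
  also have "\<dots> = pochhammer (of_nat (Suc (k - j))) (CARD('n) - k) * minor_sum j A"
    using assms coeff_minor_pencil_card_mat_1[of j A] by (simp add: coeff_higher_pderiv)
  also have "pochhammer (of_nat (Suc (k - j))) (CARD('n) - k) =
      (of_nat (CARD('n) - j choose (k - j)) * fact (CARD('n) - k) :: 'a)"
  proof -
    have "fact (k - j) * pochhammer (of_nat (Suc (k - j))) (CARD('n) - k) = (fact (CARD('n) - j) :: 'a)"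
      using pochhammer_product[of "k - j" "CARD('n) - j" "1 :: 'a"] assms
      by (simp add: pochhammer_fact)
    also have "\<dots> = of_nat (fact (k - j) * fact (CARD('n) - k) * (CARD('n) - j choose (k - j)))"
      using binomial_fact_lemma[of "k - j" "CARD('n) - j"] assms by simp
    also have "\<dots> = fact (k - j) * (of_nat (CARD('n) - j choose (k - j)) * fact (CARD('n) - k))"
      by (simp add: mult_ac)
    finally show ?thesis by simp
  qed
  finally show ?thesis by simp
qed

lemma minor_sum_add_mat:
  fixes A :: "real^'n^'n"
  assumes "k \<le> CARD('n)"
  shows "minor_sum k (A + mat t) = (\<Sum>j\<le>k. real (CARD('n) - j choose (k - j)) * minor_sum j A * t ^ (k - j))"
proof -
  let ?p = "minor_pencil k A (mat 1)"
  have "degree ?p = k"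
    using assms by (intro degree_minor_pencil) (simp add: minor_sum_mat)
  then have "minor_sum k (A + mat t) = (\<Sum>i\<le>k. coeff ?p i * t ^ i)"
    by (simp add: poly_altdef flip: poly_minor_pencil_mat_1)
  also have "\<dots> = (\<Sum>j\<le>k. coeff ?p (k - j) * t ^ (k - j))"
    by (rule sum.reindex_bij_witness[of _ "\<lambda>j. k - j" "\<lambda>i. k - i"]) auto
  finally show ?thesis using assms by (simp add: coeff_minor_pencil_mat_1)
qed

lemma minor_sum_add_mat_ge:
  fixes A :: "real^'n^'n"
  assumes k_le_card: "k \<le> CARD('n)" and nonneg: "\<And>j. j \<le> k \<Longrightarrow> minor_sum j A \<ge> 0" and t_nonneg: "t \<ge> 0"
  shows "minor_sum k (A + mat t) \<ge> minor_sum k A"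
    and "minor_sum k (A + mat t) \<ge> real (CARD('n) choose k) * t ^ k"
proof -
  let ?f = "\<lambda>j. real (CARD('n) - j choose (k - j)) * minor_sum j A * t ^ (k - j)"
  have "?f j \<le> minor_sum k (A + mat t)" if "j \<le> k" for j
    unfolding minor_sum_add_mat[OF k_le_card]
    using that nonneg t_nonneg by (intro member_le_sum) auto
  from this[of k] this[of 0] show "minor_sum k (A + mat t) \<ge> minor_sum k A"
    and "minor_sum k (A + mat t) \<ge> real (CARD('n) choose k) * t ^ k"
    by simp_all
qed

abbreviation complex_matrix :: "real^'n^'m \<Rightarrow> complex^'n^'m" where
  "complex_matrix \<equiv> map_matrix complex_of_real"

lemma poly_complex_minor_pencil_mat_1:
  "poly (map_poly complex_of_real (minor_pencil k A (mat 1))) z = minor_sum k (complex_matrix A + mat z)"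
  for A :: "real^'n^'n"
proof -
  have "complex_matrix (mat 1) = (mat 1 :: complex^'n^'n)" by (simp add: vec_eq_iff mat_def)
  then show ?thesis by (simp add: map_poly_minor_pencil poly_minor_pencil_mat_1)
qed

lemma poly_complex_minor_pencil_add_mat:
  "poly (minor_pencil k (complex_matrix A + mat t) (complex_matrix B)) (of_real v) =
    poly (map_poly complex_of_real (minor_pencil k (A + v *\<^sub>R B) (mat 1))) t"
proof -
  have "(\<chi> i j. (complex_matrix A + mat t) $ i $ j + of_real v * complex_matrix B $ i $ j) =
      complex_matrix (A + v *\<^sub>R B) + mat t"
    by (simp add: vec_eq_iff mat_def)
  then show ?thesis by (simp add: poly_minor_pencil poly_complex_minor_pencil_mat_1)
qed

lemma det_symmetric_add_mat_nonzero:
  fixes A :: "real^'n^'n"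
  assumes sym: "transpose A = A" and Im_t: "Im t \<noteq> 0"
  shows "det (complex_matrix A + mat t) \<noteq> 0"
proof -
  have "z = 0" if ker: "(complex_matrix A + mat t) *v z = 0" for z :: "complex^'n"
  proof -
    define H where "H = (\<Sum>i\<in>UNIV. \<Sum>j\<in>UNIV. cnj (z $ i) * of_real (A $ i $ j) * z $ j)"
    define N where "N = (\<Sum>i\<in>UNIV. (cmod (z $ i))\<^sup>2)"
    have entry_sym: "A $ i $ j = A $ j $ i" for i j
      using sym by (metis transpose_def vec_lambda_beta)
    have "cnj H = (\<Sum>i\<in>UNIV. \<Sum>j\<in>UNIV. z $ i * of_real (A $ i $ j) * cnj (z $ j))"
      by (simp add: H_def)
    also have "\<dots> = H"
      unfolding H_def by (subst sum.swap) (simp add: entry_sym mult_ac)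
    finally have "Im H = 0" by (simp add: complex_eq_iff)
    have N_eq: "of_real N = (\<Sum>i\<in>UNIV. z $ i * cnj (z $ i))"
      by (simp only: N_def of_real_sum complex_norm_square)
    have "mat t *v z = (\<chi> i. t * z $ i)"
      by (simp add: vec_eq_iff matrix_vector_mult_def mat_def if_distrib[of "\<lambda>x. x * _"] cong: if_cong)
    then have "0 = (complex_matrix A *v z) $ i + t * z $ i" for i
      using ker by (simp add: matrix_vector_mult_add_rdistrib vec_eq_iff)
    then have "0 = (\<Sum>i\<in>UNIV. cnj (z $ i) * ((complex_matrix A *v z) $ i + t * z $ i))"
      by simp
    also have "\<dots> = H + t * of_real N"
      by (simp add: H_def N_eq matrix_vector_mult_def distrib_left sum.distrib sum_distrib_left mult_ac)
    finally have "Im (H + t * of_real N) = 0" by simp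
    then have "N = 0" using \<open>Im H = 0\<close> Im_t by simp
    then show "z = 0" by (simp add: N_def sum_nonneg_eq_0_iff vec_eq_iff)
  qed
  then have "\<exists>B. B ** (complex_matrix A + mat t) = mat 1"
    by (simp add: matrix_left_invertible_ker)
  then show ?thesis using invertible_det_nz invertible_left_inverse by blast
qed

lemma real_rooted_minor_pencil_mat_1:
  fixes A :: "real^'n^'n"
  assumes "transpose A = A" and "k \<le> CARD('n)"
  shows "real_rooted (minor_pencil k A (mat 1))"
proof -
  let ?p = "minor_pencil CARD('n) A (mat 1)"
  have "real_rooted ?p"
    using det_symmetric_add_mat_nonzero[OF assms(1)]
    by (intro real_rootedI) (simp add: poly_complex_minor_pencil_mat_1 minor_sum_card)
  moreover have "degree ?p = CARD('n)"
    by (rule degree_minor_pencil) (simp add: minor_sum_mat)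
  ultimately have "real_rooted ((pderiv ^^ (CARD('n) - k)) ?p)"
    by (intro real_rooted_higher_pderiv) simp_all
  then show ?thesis
    by (simp add: real_rooted_def higher_pderiv_minor_pencil_mat_1[OF assms(2)] map_poly_smult)
qed

section \<open>The Garding cone\<close>

lemma transpose_add: "transpose (A + B) = transpose A + transpose B"
  and transpose_diff: "transpose (C - D) = transpose C - transpose D"
  by (simp_all add: transpose_def vec_eq_iff)

lemma mat_eq_scaleR_mat_1: "mat c = c *\<^sub>R (mat 1 :: real^'n^'n)"
  by (simp add: mat_def vec_eq_iff)

definition garding_cone :: "nat \<Rightarrow> (real^'n^'n) set" where
  "garding_cone k = {A. transpose A = A \<and> (\<forall>j\<le>k. minor_sum j A > 0)}"

lemma garding_cone_symmetric: "A \<in> garding_cone k \<Longrightarrow> transpose A = A"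
  and garding_cone_minor_sum_pos: "A \<in> garding_cone k \<Longrightarrow> j \<le> k \<Longrightarrow> minor_sum j A > 0"
  and garding_cone_mono: "A \<in> garding_cone k \<Longrightarrow> j \<le> k \<Longrightarrow> A \<in> garding_cone j"
  by (auto simp: garding_cone_def)

lemma garding_cone_scaleR:
  assumes "A \<in> garding_cone k" and "c > 0"
  shows "c *\<^sub>R A \<in> garding_cone k"
  using assms by (simp add: garding_cone_def minor_sum_scaleR transpose_scalar)

lemma add_mat_in_garding_cone:
  fixes A :: "real^'n^'n"
  assumes "transpose A = A" and "\<And>j. j \<le> k \<Longrightarrow> minor_sum j A \<ge> 0" and "k \<le> CARD('n)" and "t > 0"
  shows "A + mat t \<in> garding_cone k"
proof -
  have "minor_sum j (A + mat t) > 0" if "j \<le> k" for j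
  proof -
    have "0 < real (CARD('n) choose j) * t ^ j" using assms that by simp
    also have "\<dots> \<le> minor_sum j (A + mat t)"
      using assms that by (intro minor_sum_add_mat_ge) auto
    finally show ?thesis .
  qed
  then show ?thesis using assms(1) by (simp add: garding_cone_def transpose_add)
qed

lemma garding_cone_segment_mat_1:
  fixes A :: "real^'n^'n"
  assumes A_cone: "A \<in> garding_cone k" and k_le_card: "k \<le> CARD('n)" and s_unit: "s \<in> {0..1}"
  shows "s *\<^sub>R A + mat (1 - s) \<in> garding_cone k"
proof (cases "s = 1")
  case False
  have "transpose (s *\<^sub>R A) = s *\<^sub>R A"
    using garding_cone_symmetric[OF A_cone] by (simp add: transpose_scalar)
  moreover have "minor_sum j (s *\<^sub>R A) \<ge> 0" if "j \<le> k" for j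
    using garding_cone_minor_sum_pos[OF A_cone that] s_unit by (simp add: minor_sum_scaleR)
  ultimately show ?thesis
    using False s_unit k_le_card by (intro add_mat_in_garding_cone) auto
qed (use A_cone in simp)

lemma garding_coneI_nonneg:
  fixes A :: "real^'n^'n"
  assumes sym: "transpose A = A" and k_le_card: "k \<le> CARD('n)"
    and nonneg: "\<And>j. j \<le> k \<Longrightarrow> minor_sum j A \<ge> 0" and top_pos: "minor_sum k A > 0"
  shows "A \<in> garding_cone k"
proof -
  let ?p = "minor_pencil k A (mat 1)"
  have lead_pos: "minor_sum k (mat 1 :: real^'n^'n) > 0"
    using k_le_card by (simp add: minor_sum_mat)
  then have degree_p: "degree ?p = k" by (intro degree_minor_pencil) simp
  have "x < 0" if "poly ?p x = 0" for x
    using minor_sum_add_mat_ge(1)[OF k_le_card nonneg, of x] that top_pos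
    by (force simp: poly_minor_pencil_mat_1)
  moreover have "lead_coeff ?p > 0" using lead_pos by (simp add: degree_p coeff_minor_pencil_top)
  ultimately have coeff_pos: "coeff ?p (k - j) > 0" for j
    using real_rooted_coeff_pos[OF real_rooted_minor_pencil_mat_1[OF sym k_le_card]] degree_p by simp
  have "minor_sum j A > 0" if "j \<le> k" for j
    using coeff_pos[of j]
    by (simp add: coeff_minor_pencil_mat_1[OF that k_le_card] zero_less_mult_iff)
  then show ?thesis using sym by (simp add: garding_cone_def)
qed

lemma openin_garding_cone: "openin (top_of_set {A. transpose A = A}) (garding_cone k :: (real^'n^'n) set)"
proof -
  have "open (\<Inter>j\<le>k. {A :: real^'n^'n. minor_sum j A > 0})"
    by (intro open_INT ballI open_Collect_less continuous_on_minor_sum continuous_intros) auto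
  moreover have "garding_cone k = {A :: real^'n^'n. transpose A = A} \<inter> (\<Inter>j\<le>k. {A. minor_sum j A > 0})"
    by (auto simp: garding_cone_def)
  ultimately show ?thesis by (simp add: openin_open_Int)
qed

lemma garding_cone_diff_mat:
  fixes A :: "real^'n^'n"
  assumes A_cone: "A \<in> garding_cone k"
  obtains e where "e > 0" and "A - mat e \<in> garding_cone k"
proof -
  obtain r where ball: "r > 0" "cball A r \<inter> {A. transpose A = A} \<subseteq> garding_cone k"
    using openin_garding_cone A_cone unfolding openin_contains_cball by blast
  define e where "e = r / norm (mat 1 :: real^'n^'n)"
  have norm_mat_1_pos: "norm (mat 1 :: real^'n^'n) > 0" by (auto simp: vec_eq_iff mat_def)
  have "dist A (A - mat e) \<le> r"
    using ball(1) norm_mat_1_pos by (simp add: dist_norm e_def mat_eq_scaleR_mat_1[of "r / _"])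
  moreover have "transpose (A - mat e) = A - mat e"
    using garding_cone_symmetric[OF A_cone] by (simp add: transpose_diff)
  ultimately have "A - mat e \<in> garding_cone k" using ball(2) by auto
  moreover have "e > 0" using ball(1) norm_mat_1_pos by (simp add: e_def)
  ultimately show ?thesis by (rule that[rotated])
qed

lemma connected_subset_garding_cone:
  fixes T :: "(real^'n^'n) set"
  assumes region: "connected T" "T \<subseteq> {A. transpose A = A \<and> minor_sum k A > 0}"
    and point: "A \<in> T" "A \<in> garding_cone k" and k_le_card: "k \<le> CARD('n)"
  shows "T \<subseteq> garding_cone k"
proof -
  obtain U where "open U" "garding_cone k = {A :: real^'n^'n. transpose A = A} \<inter> U"
    using openin_garding_cone by (auto simp: openin_open)
  then have "openin (top_of_set T) (T \<inter> garding_cone k)"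
    using region(2) by (auto simp: openin_open)
  moreover have "T \<inter> garding_cone k = T \<inter> (\<Inter>j\<le>k. {A. minor_sum j A \<ge> 0})"
    using region(2) garding_coneI_nonneg[OF _ k_le_card]
    by (auto dest: garding_cone_minor_sum_pos simp: less_imp_le)
  moreover have "closed (\<Inter>j\<le>k. {A :: real^'n^'n. minor_sum j A \<ge> 0})"
    by (intro closed_INT ballI closed_Collect_le continuous_on_minor_sum continuous_intros)
  ultimately have "T \<inter> garding_cone k = {} \<or> T \<inter> garding_cone k = T"
    using region(1) by (metis closedin_closed_Int connected_clopen)
  then show ?thesis using point by auto
qed

section \<open>Garding's theorem\<close>

lemma garding_cone_add_mat_root_neg:
  fixes A :: "real^'n^'n"
  assumes A_cone: "A \<in> garding_cone k" and k_le_card: "k \<le> CARD('n)"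
    and root: "minor_sum k (complex_matrix A + mat z) = 0"
  shows "Im z = 0" and "Re z < 0"
proof -
  let ?p = "minor_pencil k A (mat 1)"
  have "poly (map_poly complex_of_real ?p) z = 0"
    using root by (simp add: poly_complex_minor_pencil_mat_1)
  then show "Im z = 0"
    using real_rooted_minor_pencil_mat_1[OF garding_cone_symmetric[OF A_cone] k_le_card]
    by (simp add: real_rooted_def)
  then have "complex_matrix A + mat z = complex_matrix (A + mat (Re z))"
    by (simp add: vec_eq_iff mat_def complex_eq_iff)
  then have "minor_sum k (A + mat (Re z)) = 0"
    using root by (simp add: minor_sum_of_real)
  moreover have "minor_sum k (A + mat (Re z)) \<ge> minor_sum k A" if "Re z \<ge> 0"
    using that garding_cone_minor_sum_pos[OF A_cone]
    by (intro minor_sum_add_mat_ge(1) k_le_card) (auto simp: less_imp_le)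
  ultimately show "Re z < 0"
    using garding_cone_minor_sum_pos[OF A_cone order_refl] by force
qed

lemma garding_cone_mat_pencil_root:
  fixes B :: "real^'n^'n"
  assumes B_cone: "B \<in> garding_cone k" and k_le_card: "k \<le> CARD('n)" and t_nonzero: "t \<noteq> 0"
    and root: "poly (minor_pencil k (mat t) (complex_matrix B)) z = 0"
  obtains c where "c < 0" and "z = of_real c * t"
proof -
  have "z \<noteq> 0"
  proof
    assume "z = 0"
    then have "minor_sum k (mat t :: complex^'n^'n) = 0" using root by (simp add: poly_minor_pencil)
    then show False using t_nonzero k_le_card by (simp add: minor_sum_mat)
  qed
  then have "poly (minor_pencil k (complex_matrix B) (mat t)) (1 / z) = 0"
    using root minor_pencil_swap[of z k "mat t" "complex_matrix B"] by simp
  moreover have "(\<chi> i j. complex_matrix B $ i $ j + 1 / z * mat t $ i $ j) = complex_matrix B + mat (t / z)"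
    by (simp add: vec_eq_iff mat_def)
  ultimately have "minor_sum k (complex_matrix B + mat (t / z)) = 0"
    by (simp only: poly_minor_pencil)
  note root_neg = garding_cone_add_mat_root_neg[OF B_cone k_le_card this]
  define x where "x = Re (t / z)"
  have "t / z = of_real x" using root_neg(1) by (simp add: x_def complex_eq_iff)
  then have "z = of_real (1 / x) * t"
    using \<open>z \<noteq> 0\<close> t_nonzero by (auto simp: field_simps)
  moreover have "1 / x < 0" using root_neg(2) by (simp add: x_def)
  ultimately show ?thesis using that by blast
qed

text \<open>Scale \<open>X\<close> down to 0. On the way no root becomes real, since \<open>t\<close> is not real.\<close>

lemma shifted_pencil_nonzero_upper_half_plane:
  fixes X B :: "real^'n^'n"
  assumes X_sym: "transpose X = X" and B_cone: "B \<in> garding_cone k" and k_le_card: "k \<le> CARD('n)"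
    and Im_t: "Im t > 0" and Im_u: "Im u > 0"
  shows "poly (minor_pencil k (complex_matrix X + mat t) (complex_matrix B)) u \<noteq> 0"
proof -
  define p where "p s = minor_pencil k (complex_matrix (s *\<^sub>R X) + mat t) (complex_matrix B)" for s
  have "minor_sum k (complex_matrix B) \<noteq> 0"
    using garding_cone_minor_sum_pos[OF B_cone, of k] by (simp add: minor_sum_of_real)
  then have degree_p: "p s \<noteq> 0 \<and> degree (p s) = k" for s
    by (simp add: p_def degree_minor_pencil minor_pencil_nonzero)
  have no_real_root: "poly (p s) (of_real v) \<noteq> 0" for s v
  proof -
    have "transpose (s *\<^sub>R X + v *\<^sub>R B) = s *\<^sub>R X + v *\<^sub>R B"
      using X_sym garding_cone_symmetric[OF B_cone] by (simp add: transpose_add transpose_scalar)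
    from real_rooted_minor_pencil_mat_1[OF this k_le_card] show ?thesis
      using Im_t by (auto simp: p_def poly_complex_minor_pencil_add_mat real_rooted_def)
  qed
  have no_root_start: "poly (p 0) z \<noteq> 0" if "Im z > 0" for z
  proof
    assume "poly (p 0) z = 0"
    moreover have "complex_matrix (0 *\<^sub>R X) + mat t = mat t" by (simp add: vec_eq_iff)
    ultimately have "poly (minor_pencil k (mat t) (complex_matrix B)) z = 0" by (simp add: p_def)
    moreover have "t \<noteq> 0" using Im_t by auto
    ultimately obtain c where "c < 0" "z = of_real c * t"
      using garding_cone_mat_pencil_root[OF B_cone k_le_card] by blast
    then show False using Im_t \<open>Im z > 0\<close> by (simp add: zero_less_mult_iff)
  qed
  have frontier: "frontier {z. Im z > 0} = {z. Im z = 0}"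
    using frontier_halfspace_gt[of \<i> 0] by simp
  have "poly (p 1) u \<noteq> 0"
  proof (rule poly_roots_avoid_open_set[where S = "{0..1}" and U = "{z. Im z > 0}" and p = p and ?s0.0 = 0])
    show "continuous_on {0..1} (\<lambda>s. coeff (p s) i)" for i
      unfolding p_def map_matrix_def by (intro continuous_on_coeff_minor_pencil continuous_intros)
    show "poly (p s) z \<noteq> 0" if "z \<in> frontier {z. Im z > 0}" for s z
      using that no_real_root[of s "Re z"] by (simp add: frontier complex_is_Real_iff)
  qed (use Im_u no_root_start degree_p in \<open>auto intro!: open_halfspace_Im_gt\<close>)
  then show ?thesis by (simp add: p_def)
qed

lemma real_rooted_minor_pencil:
  fixes X B :: "real^'n^'n"
  assumes X_sym: "transpose X = X" and B_cone: "B \<in> garding_cone k" and k_le_card: "k \<le> CARD('n)"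
  shows "real_rooted (minor_pencil k X B)"
proof (rule real_rootedI)
  fix z assume Im_z: "Im z > 0"
  obtain e where shift: "e > 0" "B - mat e \<in> garding_cone k"
    by (rule garding_cone_diff_mat[OF B_cone])
  have "poly (map_poly complex_of_real (minor_pencil k X B)) z =
      poly (minor_pencil k (complex_matrix X + mat (z * of_real e)) (complex_matrix (B - mat e))) z"
    unfolding map_poly_minor_pencil poly_minor_pencil
    by (rule arg_cong[of _ _ "minor_sum k"]) (simp add: vec_eq_iff mat_def algebra_simps)
  also have "\<dots> \<noteq> 0"
    using Im_z shift(1)
    by (intro shifted_pencil_nonzero_upper_half_plane X_sym shift(2) k_le_card) simp_all
  finally show "poly (map_poly complex_of_real (minor_pencil k X B)) z \<noteq> 0" .
qed

lemma garding_cone_pencil_nonzero_imaginary_axis: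
  fixes A B :: "real^'n^'n"
  assumes A_cone: "A \<in> garding_cone k" and B_cone: "B \<in> garding_cone k"
    and k_le_card: "k \<le> CARD('n)" and Re_z: "Re z = 0"
  shows "poly (map_poly complex_of_real (minor_pencil k A B)) z \<noteq> 0"
proof
  assume root: "poly (map_poly complex_of_real (minor_pencil k A B)) z = 0"
  then have "Im z = 0"
    using real_rooted_minor_pencil[OF garding_cone_symmetric[OF A_cone] B_cone k_le_card]
    by (simp add: real_rooted_def)
  then have "z = of_real 0" using Re_z by (simp add: complex_eq_iff)
  then have "poly (minor_pencil k A B) 0 = 0"
    using root by (simp only: poly_map_poly_of_real of_real_eq_0_iff)
  then show False
    using garding_cone_minor_sum_pos[OF A_cone order_refl] by (simp add: poly_minor_pencil_real)
qed

lemma garding_cone_pencil_nonzero_right_half_plane: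
  fixes A B :: "real^'n^'n"
  assumes A_cone: "A \<in> garding_cone k" and B_cone: "B \<in> garding_cone k"
    and k_le_card: "k \<le> CARD('n)" and Re_z: "Re z > 0"
  shows "poly (map_poly complex_of_real (minor_pencil k A B)) z \<noteq> 0"
proof -
  define M where "M s = s *\<^sub>R A + (1 - s) *\<^sub>R mat 1" for s
  define p where "p s = map_poly complex_of_real (minor_pencil k (M s) B)" for s
  have B_pos: "minor_sum k B > 0" using garding_cone_minor_sum_pos[OF B_cone] by simp
  have M_cone: "M s \<in> garding_cone k" if "s \<in> {0..1}" for s
    using garding_cone_segment_mat_1[OF A_cone k_le_card that]
    by (simp add: M_def flip: mat_eq_scaleR_mat_1)
  have no_root_start: "poly (p 0) w \<noteq> 0" if "Re w > 0" for w
  proof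
    assume "poly (p 0) w = 0"
    moreover have "complex_matrix (M 0) = mat 1" by (simp add: M_def vec_eq_iff mat_def)
    ultimately have "poly (minor_pencil k (mat 1) (complex_matrix B)) w = 0"
      by (simp add: p_def map_poly_minor_pencil)
    then obtain c where "c < 0" "w = of_real c * 1"
      using garding_cone_mat_pencil_root[OF B_cone k_le_card one_neq_zero] by blast
    with that show False by simp
  qed
  have "poly (p 1) z \<noteq> 0"
  proof (rule poly_roots_avoid_open_set[where S = "{0..1}" and U = "{z. Re z > 0}" and p = p and ?s0.0 = 0])
    show "p s \<noteq> 0 \<and> degree (p s) = k" for s
      using B_pos
      by (simp add: p_def degree_map_poly degree_minor_pencil map_poly_eq_0_iff minor_pencil_nonzero)
    show "continuous_on {0..1} (\<lambda>s. coeff (p s) i)" for i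
      unfolding p_def M_def
      by (simp add: coeff_map_poly) (intro continuous_intros continuous_on_coeff_minor_pencil)
    show "poly (p s) w \<noteq> 0" if "s \<in> {0..1}" "w \<in> frontier {z. Re z > 0}" for s w
      using that garding_cone_pencil_nonzero_imaginary_axis[OF M_cone B_cone k_le_card]
        frontier_halfspace_gt[of "1::complex" 0] by (simp add: p_def)
  qed (use Re_z no_root_start in \<open>auto intro!: open_halfspace_Re_gt\<close>)
  then show ?thesis by (simp add: p_def M_def)
qed

lemma garding_cone_pencil_root_neg:
  fixes A B :: "real^'n^'n"
  assumes A_cone: "A \<in> garding_cone k" and B_cone: "B \<in> garding_cone k"
    and k_le_card: "k \<le> CARD('n)" and root: "poly (minor_pencil k A B) x = 0"
  shows "x < 0"
proof -
  have "poly (map_poly complex_of_real (minor_pencil k A B)) (of_real x) = 0"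
    using root by (simp add: poly_map_poly_of_real)
  then have "\<not> x > 0"
    using garding_cone_pencil_nonzero_right_half_plane[OF A_cone B_cone k_le_card, of "of_real x"]
    by auto
  moreover have "x \<noteq> 0"
    using root garding_cone_minor_sum_pos[OF A_cone, of k] by (auto simp: poly_minor_pencil_real)
  ultimately show ?thesis by simp
qed

lemma garding_cone_pencil_factorization:
  fixes A B :: "real^'n^'n"
  assumes A_cone: "A \<in> garding_cone k" and B_cone: "B \<in> garding_cone k"
    and k_le_card: "k \<le> CARD('n)"
  obtains c where "\<And>i. i < k \<Longrightarrow> c i > 0"
    and "\<And>s. minor_sum k (A + s *\<^sub>R B) = minor_sum k B * (\<Prod>i<k. s + c i)"
proof -
  let ?p = "minor_pencil k A B"
  have "degree ?p = k"
    using garding_cone_minor_sum_pos[OF B_cone, of k] by (intro degree_minor_pencil) simp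
  moreover have "real_rooted ?p"
    by (rule real_rooted_minor_pencil[OF garding_cone_symmetric[OF A_cone] B_cone k_le_card])
  ultimately obtain c where pencil_factors: "?p = smult (minor_sum k B) (\<Prod>i<k. [:- c i, 1:])"
    using real_rooted_factorization[of ?p "{..<k}"] by (auto simp: coeff_minor_pencil_top)
  have "c i < 0" if "i < k" for i
    by (rule garding_cone_pencil_root_neg[OF A_cone B_cone k_le_card])
      (use that in \<open>auto simp: pencil_factors poly_prod\<close>)
  moreover have "minor_sum k (A + s *\<^sub>R B) = minor_sum k B * (\<Prod>i<k. s + - c i)" for s
    unfolding poly_minor_pencil_real[symmetric] pencil_factors by (simp add: poly_prod)
  ultimately show ?thesis using that[of "\<lambda>i. - c i"] by simp
qed

lemma garding_cone_add:
  fixes A B :: "real^'n^'n"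
  assumes A_cone: "A \<in> garding_cone k" and B_cone: "B \<in> garding_cone k"
    and k_le_card: "k \<le> CARD('n)"
  shows "A + B \<in> garding_cone k"
proof -
  have "minor_sum j (A + B) > 0" if "j \<le> k" for j
  proof -
    note cones = garding_cone_mono[OF A_cone that] garding_cone_mono[OF B_cone that]
    have j_le_card: "j \<le> CARD('n)" using that k_le_card by simp
    obtain c where factors: "\<And>i. i < j \<Longrightarrow> c i > 0"
      "\<And>s. minor_sum j (A + s *\<^sub>R B) = minor_sum j B * (\<Prod>i<j. s + c i)"
      using garding_cone_pencil_factorization[OF cones j_le_card] by blast
    have "(\<Prod>i<j. 1 + c i) > 0" using factors(1) by (intro prod_pos) (simp add: add_pos_pos)
    then show ?thesis
      using factors(2)[of 1] garding_cone_minor_sum_pos[OF cones(2)] by simp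
  qed
  then show ?thesis
    using garding_cone_symmetric[OF A_cone] garding_cone_symmetric[OF B_cone]
    by (simp add: garding_cone_def transpose_add)
qed

lemma garding_cone_add_nonneg:
  fixes A B :: "real^'n^'n"
  assumes A_cone: "A \<in> garding_cone k" and k_le_card: "k \<le> CARD('n)"
    and B_nonneg: "transpose B = B" "\<And>j. j \<le> k \<Longrightarrow> minor_sum j B \<ge> 0"
  shows "A + B \<in> garding_cone k"
proof -
  obtain e where shift: "e > 0" "A - mat e \<in> garding_cone k"
    by (rule garding_cone_diff_mat[OF A_cone])
  have "B + mat e \<in> garding_cone k"
    by (rule add_mat_in_garding_cone[OF B_nonneg k_le_card shift(1)])
  from garding_cone_add[OF shift(2) this k_le_card] show ?thesis by (simp add: add.commute)
qed

section \<open>Eigenvalues\<close>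

lemma charpoly_eq_minor_pencil: "charpoly r = minor_pencil CARD('n) (- r) (mat 1)" for r :: "real^'n^'n"
proof -
  have "poly (charpoly r) t = poly (minor_pencil CARD('n) (- r) (mat 1)) t" for t
  proof -
    have "poly (charpoly r) t = det (\<chi> i j. poly ((if i = j then [:0, 1:] else 0) - [:r $ i $ j:]) t)"
      by (simp add: charpoly_def det_def poly_sum poly_prod of_int_poly)
    also have "(\<chi> i j. poly ((if i = j then [:0, 1:] else 0) - [:r $ i $ j:]) t) = - r + mat t"
      by (simp add: vec_eq_iff mat_def)
    finally show ?thesis by (simp add: poly_minor_pencil_mat_1 minor_sum_card)
  qed
  then show ?thesis by (intro poly_eq_poly_eq_iff[THEN iffD1] ext)
qed

lemma minor_sum_eq_if_charpoly_eq:
  fixes r s :: "real^'n^'n"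
  assumes "charpoly r = charpoly s" and "j \<le> CARD('n)"
  shows "minor_sum j r = minor_sum j s"
proof -
  have "coeff (charpoly r) (CARD('n) - j) = (- 1) ^ j * minor_sum j r" for r :: "real^'n^'n"
    using coeff_minor_pencil_card_mat_1[OF assms(2), of "- r"] minor_sum_scaleR[of j "- 1" r]
    by (simp add: charpoly_eq_minor_pencil)
  then have "(- 1) ^ j * minor_sum j r = (- 1) ^ j * minor_sum j s" using assms(1) by metis
  then show ?thesis by simp
qed

lemma charpoly_diagonal: "charpoly (\<chi> i j. if i = j then d i else 0) = (\<Prod>i\<in>UNIV. [:- d i, 1:])"
  unfolding charpoly_def by (subst det_diagonal) auto

lemma charpoly_eq_prod_eigvals:
  fixes r :: "real^'n^'n"
  assumes "transpose r = r"
  shows "charpoly r = (\<Prod>i\<in>UNIV. [:- eigvals r i, 1:])"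
proof -
  have "transpose (- r) = - r" using assms by (simp add: transpose_def vec_eq_iff)
  then have "real_rooted (charpoly r)"
    by (simp add: charpoly_eq_minor_pencil real_rooted_minor_pencil_mat_1)
  moreover have "degree (charpoly r) = CARD('n)" "lead_coeff (charpoly r) = 1"
    by (simp_all add: charpoly_eq_minor_pencil degree_minor_pencil coeff_minor_pencil_top minor_sum_mat)
  ultimately obtain lam :: "'n \<Rightarrow> real" where "charpoly r = (\<Prod>i\<in>UNIV. [:- lam i, 1:])"
    using real_rooted_factorization[of "charpoly r" "UNIV :: 'n set"] by auto
  then show ?thesis unfolding eigvals_def
    by (rule someI[where P = "\<lambda>lam. charpoly r = (\<Prod>i\<in>UNIV. [:- lam i, 1:])"])
qed

lemma sigma_eq_minor_sum:
  fixes r :: "real^'n^'n"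
  assumes "transpose r = r"
  shows "sigma j r = minor_sum j r"
proof (cases "j \<le> CARD('n)")
  case True
  have "charpoly r = charpoly (\<chi> i j. if i = j then eigvals r i else 0)"
    by (simp add: charpoly_eq_prod_eigvals[OF assms] charpoly_diagonal)
  from minor_sum_eq_if_charpoly_eq[OF this True] show ?thesis
    by (simp add: minor_sum_diagonal sigma_def)
next
  case False
  then have "{I :: 'n set. card I = j} = {}" using card_mono[of "UNIV :: 'n set"] by auto
  then show ?thesis by (simp add: sigma_def minor_sum_def)
qed

lemma Gamma_plus_iff_garding_cone:
  assumes "transpose r = r"
  shows "r \<in> Gamma_plus k \<longleftrightarrow> r \<in> garding_cone k"
proof -
  have "r \<in> Gamma_plus k \<longleftrightarrow> (\<forall>j. 1 \<le> j \<and> j \<le> k \<longrightarrow> minor_sum j r > 0)"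
    by (simp add: Gamma_plus_def sigma_eq_minor_sum[OF assms])
  also have "\<dots> \<longleftrightarrow> (\<forall>j\<le>k. minor_sum j r > 0)"
    by (metis minor_sum_0 not_less_eq_eq le_0_eq One_nat_def zero_less_one)
  finally show ?thesis using assms by (simp add: garding_cone_def)
qed

section \<open>Rank-one updates\<close>

definition outer :: "'a::times^'m \<Rightarrow> 'a^'n \<Rightarrow> 'a^'n^'m" where
  "outer x y = (\<chi> i j. x $ i * y $ j)"

lemma det_row_replaced_add_outer:
  fixes A :: "'a::comm_ring_1^'n^'n"
  assumes "finite S" and "l \<notin> S"
  shows "det (\<chi> i. if i = l then y else if i \<in> S then A $ i + x $ i *s y else A $ i) =
    det (\<chi> i. if i = l then y else A $ i)"
  using assms
proof (induction S rule: finite_induct)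
  case (insert m S)
  let ?M = "\<chi> i. if i = l then y else if i \<in> S then A $ i + x $ i *s y else A $ i"
  have "(\<chi> i. if i = m then row m ?M + x $ m *s row l ?M else row i ?M) =
      (\<chi> i. if i = l then y else if i \<in> insert m S then A $ i + x $ i *s y else A $ i)"
    using insert.hyps insert.prems by (auto simp: vec_eq_iff row_def)
  moreover have "m \<noteq> l" using insert.prems by auto
  ultimately show ?case
    using insert.IH insert.prems det_row_operation[of m l ?M "x $ m"] by simp
qed (simp cong: if_cong)

lemma det_add_outer:
  fixes A :: "'a::comm_ring_1^'n^'n"
  shows "det (A + outer x y) = det A + (\<Sum>l\<in>UNIV. x $ l * det (\<chi> i. if i = l then y else A $ i))"
proof -
  define B where "B S i = (if i \<in> S then A $ i + x $ i *s y else A $ i)" for S i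
  have "det (\<chi> i. B S i) = det A + (\<Sum>l\<in>S. x $ l * det (\<chi> i. if i = l then y else A $ i))"
    if "finite S" for S
    using that
  proof (induction S rule: finite_induct)
    case empty
    have "(\<chi> i. B {} i) = A" by (simp add: B_def vec_eq_iff)
    then show ?case by simp
  next
    case (insert l S)
    have "(\<chi> i. B (insert l S) i) = (\<chi> i. if i = l then A $ i + x $ l *s y else B S i)"
      by (auto simp: B_def vec_eq_iff)
    then have "det (\<chi> i. B (insert l S) i) =
        det (\<chi> i. if i = l then A $ i else B S i) + x $ l * det (\<chi> i. if i = l then y else B S i)"
      using det_row_add[of l "\<lambda>i. A $ i" "\<lambda>_. x $ l *s y" "B S"] det_row_mul[of l "x $ l" "\<lambda>_. y" "B S"]
      by simp
    moreover have "(\<chi> i. if i = l then A $ i else B S i) = (\<chi> i. B S i)"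
      using insert.hyps by (auto simp: B_def vec_eq_iff)
    moreover have "det (\<chi> i. if i = l then y else B S i) = det (\<chi> i. if i = l then y else A $ i)"
      unfolding B_def by (rule det_row_replaced_add_outer[OF insert.hyps])
    ultimately show ?case using insert by simp
  qed
  from this[of UNIV] show ?thesis by (simp add: B_def outer_def plus_vec_def vector_scalar_mult_def)
qed

lemma det_mat_1_add_outer:
  fixes x y :: "'a::field^'n"
  shows "det (mat 1 + outer x y) = 1 + (\<Sum>i\<in>UNIV. x $ i * y $ i)"
proof -
  have row: "row i (mat 1 :: 'a^'n^'n) = mat 1 $ i" for i
    by (simp add: vec_eq_iff row_def)
  have "(\<Sum>i\<in>UNIV. y $ i *s row i (mat 1 :: 'a^'n^'n)) = y"
    by (simp add: vec_eq_iff row_def mat_def if_distrib cong: if_cong)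
  then have "det (\<chi> i. if i = l then y else mat 1 $ i) = y $ l" for l
    using cramer_lemma_transpose[of l y "mat 1 :: 'a^'n^'n"] by (simp only: row det_I mult_1_right)
  then show ?thesis by (simp add: det_add_outer)
qed

lemma matrix_mult_outer: "A ** outer x y = outer (A *v x) y" for A :: "'a::comm_semiring_1^'n^'m"
  by (simp add: outer_def matrix_matrix_mult_def matrix_vector_mult_def vec_eq_iff sum_distrib_right
      mult.assoc)

lemma det_add_outer_matrix_vector_mult:
  fixes A :: "'a::field^'n^'n"
  shows "det (A + outer (A *v x) y) = det A * (1 + (\<Sum>i\<in>UNIV. x $ i * y $ i))"
proof -
  have "A + outer (A *v x) y = A ** (mat 1 + outer x y)"
    by (simp add: matrix_add_ldistrib matrix_mult_outer)
  then show ?thesis by (simp add: det_mul det_mat_1_add_outer)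
qed

text \<open>Compare coefficients of powers of \<open>t\<close> in \<open>det (M + (M x) y\<^sup>T) = det M (1 + x \<cdot> y)\<close>
  for \<open>M = A + t I\<close>; the left-hand side is affine in \<open>M x = A x + t x\<close>.\<close>

lemma minor_sum_add_outer_Suc:
  fixes A :: "'a::field_char_0^'n^'n"
  assumes "k < CARD('n)"
  shows "(minor_sum (Suc k) (A + outer x y) - minor_sum (Suc k) A) +
    (minor_sum k (A + outer (A *v x) y) - minor_sum k A) = minor_sum k A * (\<Sum>i\<in>UNIV. x $ i * y $ i)"
proof -
  define p where "p B = minor_pencil CARD('n) B (mat 1)" for B :: "'a^'n^'n"
  have poly_p: "poly (p B) t = det (B + mat t)" for B t
    by (simp add: p_def poly_minor_pencil_mat_1 minor_sum_card)
  have coeff_p: "coeff (p B) (CARD('n) - j) = minor_sum j B" if "j \<le> CARD('n)" for B j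
    unfolding p_def by (rule coeff_minor_pencil_card_mat_1[OF that])
  have "(p (A + outer (A *v x) y) - p A) + pCons 0 (p (A + outer x y) - p A) =
      smult (\<Sum>i\<in>UNIV. x $ i * y $ i) (p A)"
  proof (intro poly_eq_poly_eq_iff[THEN iffD1] ext)
    fix t
    define M where "M = A + mat t"
    define L where "L z = det (M + outer z y) - det M" for z
    have det_shift: "det (A + outer z y + mat t) = L z + det M" for z
      by (simp add: L_def M_def add_ac)
    have "M *v x = A *v x + t *s x"
      by (simp add: M_def vec_eq_iff matrix_vector_mult_def mat_def distrib_right sum.distrib
          if_distrib[of "\<lambda>c. c * _"] cong: if_cong)
    then have "L (A *v x) + t * L x = L (M *v x)"
      by (simp add: L_def det_add_outer sum.distrib sum_distrib_left distrib_right mult.assoc)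
    also have "\<dots> = det M * (\<Sum>i\<in>UNIV. x $ i * y $ i)"
      by (simp add: L_def det_add_outer_matrix_vector_mult distrib_left)
    finally show "poly ((p (A + outer (A *v x) y) - p A) + pCons 0 (p (A + outer x y) - p A)) t =
        poly (smult (\<Sum>i\<in>UNIV. x $ i * y $ i) (p A)) t"
      by (simp add: poly_p det_shift mult.commute) (simp add: M_def)
  qed
  then have "coeff ((p (A + outer (A *v x) y) - p A) + pCons 0 (p (A + outer x y) - p A)) (CARD('n) - k) =
      coeff (smult (\<Sum>i\<in>UNIV. x $ i * y $ i) (p A)) (CARD('n) - k)"
    by simp
  moreover have "coeff (pCons 0 q) (CARD('n) - k) = coeff q (CARD('n) - Suc k)" for q :: "'a poly"
    using assms by (simp add: coeff_pCons Suc_diff_Suc[symmetric])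
  ultimately show ?thesis using assms by (simp add: coeff_p add.commute mult.commute)
qed

lemma mpow_mult_commute: "mpow A i ** A = A ** mpow A i"
  by (induction i) (simp_all flip: matrix_mul_assoc)

lemma minor_sum_add_outer:
  fixes A :: "real^'n^'n"
  assumes "k < CARD('n)"
  shows "minor_sum (Suc k) (A + outer x y) = minor_sum (Suc k) A +
    (\<Sum>i\<le>k. (- 1) ^ i * minor_sum (k - i) A * ((mpow A i *v x) \<bullet> y))"
  using assms
proof (induction k arbitrary: x)
  case 0
  then show ?case using minor_sum_add_outer_Suc[of 0 A x y] by (simp add: inner_vec_def)
next
  case (Suc k)
  have "mpow A i *v (A *v x) = mpow A (Suc i) *v x" for i
    by (simp add: matrix_vector_mul_assoc mpow_mult_commute)
  then have "minor_sum (Suc k) (A + outer (A *v x) y) = minor_sum (Suc k) A +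
      (\<Sum>i\<le>k. (- 1) ^ i * minor_sum (k - i) A * ((mpow A (Suc i) *v x) \<bullet> y))"
    using Suc.IH[of "A *v x"] Suc.prems by simp
  moreover have "(minor_sum (Suc (Suc k)) (A + outer x y) - minor_sum (Suc (Suc k)) A) +
      (minor_sum (Suc k) (A + outer (A *v x) y) - minor_sum (Suc k) A) = minor_sum (Suc k) A * (x \<bullet> y)"
    using minor_sum_add_outer_Suc[of "Suc k" A x y] Suc.prems by (simp add: inner_vec_def)
  ultimately show ?case
    by (simp add: sum.atMost_Suc_shift sum_negf del: sum.atMost_Suc mpow.simps(2))
qed

lemma sum_matrix_vector_mult: "(\<Sum>i\<in>I. M i) *v x = (\<Sum>i\<in>I. M i *v x)"
  for M :: "'i \<Rightarrow> 'a::comm_ring_1^'n^'m"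
  by (induction I rule: infinite_finite_induct) (simp_all add: matrix_vector_mult_add_rdistrib)

lemma minor_sum_add_outer_newton_T:
  fixes A :: "real^'n^'n"
  assumes "transpose A = A" and "k < CARD('n)"
  shows "minor_sum (Suc k) (A + outer x y) = minor_sum (Suc k) A + (newton_T k A *v x) \<bullet> y"
  unfolding minor_sum_add_outer[OF assms(2)]
  by (simp add: newton_T_def sum_matrix_vector_mult sigma_eq_minor_sum[OF assms(1)]
      inner_sum_left atLeast0AtMost scaleR_matrix_vector_assoc[symmetric])

lemma minor_sum_outer_self_nonneg:
  fixes x :: "real^'n"
  assumes "j \<le> CARD('n)"
  shows "minor_sum j (outer x x) \<ge> 0"
proof (cases j)
  case (Suc k)
  have "outer 0 x = (0 :: real^'n^'n)" by (simp add: outer_def vec_eq_iff)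
  moreover have "minor_sum i (0 :: real^'n^'n) = real (CARD('n) choose i) * 0 ^ i" for i
    using minor_sum_mat[of i "0 :: real", where 'n = 'n] by simp
  ultimately have "minor_sum j (outer x x) = real (CARD('n) choose k) * 0 ^ k * (\<Sum>i\<in>UNIV. x $ i * x $ i)"
    using minor_sum_add_outer_Suc[of k "0 :: real^'n^'n" x x] assms Suc by simp
  then show ?thesis by (simp add: sum_nonneg)
qed simp

lemma transpose_outer_self: "transpose (outer x x) = outer x x" for x :: "'a::comm_semiring_1^'n"
  by (simp add: outer_def transpose_def vec_eq_iff mult.commute)

lemma garding_cone_add_outer:
  fixes A :: "real^'n^'n"
  assumes "A \<in> garding_cone k" and "k \<le> CARD('n)"
  shows "A + outer x x \<in> garding_cone k"
  using assms
  by (intro garding_cone_add_nonneg transpose_outer_self minor_sum_outer_self_nonneg) auto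

lemma outer_scaleR_self: "outer (c *\<^sub>R x) (c *\<^sub>R x) = c\<^sup>2 *\<^sub>R outer x x" for x :: "real^'n"
  by (simp add: outer_def vec_eq_iff power2_eq_square)

lemma minor_sum_add_scaleR_outer_self:
  fixes A :: "real^'n^'n"
  assumes "transpose A = A" and "k < CARD('n)"
  shows "minor_sum (Suc k) (A + s *\<^sub>R outer x x) = minor_sum (Suc k) A + s * ((newton_T k A *v x) \<bullet> x)"
proof -
  have "s *\<^sub>R outer x x = outer (s *\<^sub>R x) x" by (simp add: outer_def vec_eq_iff)
  then show ?thesis
    using minor_sum_add_outer_newton_T[OF assms, of "s *\<^sub>R x" x]
    by (simp add: matrix_vector_mult_scaleR)
qed

lemma newton_T_nonneg:
  fixes A :: "real^'n^'n"
  assumes A_cone: "A \<in> garding_cone (Suc k)" and k_less_card: "k < CARD('n)"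
  shows "(newton_T k A *v x) \<bullet> x \<ge> 0"
proof (rule ccontr)
  define q where "q = (newton_T k A *v x) \<bullet> x"
  define s where "s = - minor_sum (Suc k) A / q"
  assume "\<not> (newton_T k A *v x) \<bullet> x \<ge> 0"
  then have "q < 0" by (simp add: q_def)
  then have "s \<ge> 0"
    using garding_cone_minor_sum_pos[OF A_cone order_refl] by (simp add: s_def divide_le_0_iff)
  then have "A + s *\<^sub>R outer x x \<in> garding_cone (Suc k)"
    using garding_cone_add_outer[OF A_cone, of "sqrt s *\<^sub>R x"] k_less_card
    by (simp add: outer_scaleR_self)
  from garding_cone_minor_sum_pos[OF this order_refl] have "minor_sum (Suc k) A + s * q > 0"
    by (simp add: minor_sum_add_scaleR_outer_self[OF garding_cone_symmetric[OF A_cone] k_less_card] q_def)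
  then show False using \<open>q < 0\<close> by (simp add: s_def)
qed

lemma minor_sum_add_outer_ge:
  fixes A :: "real^'n^'n"
  assumes A_cone: "A \<in> garding_cone (Suc k)" and k_less_card: "k < CARD('n)"
  shows "minor_sum (Suc k) (A + outer x x) \<ge> minor_sum (Suc k) A"
  using minor_sum_add_outer_newton_T[OF garding_cone_symmetric[OF A_cone] k_less_card]
    newton_T_nonneg[OF assms] by simp

lemma garding_cone_diff_outer:
  fixes A :: "real^'n^'n"
  assumes A_cone: "A \<in> garding_cone (Suc k)" and k_less_card: "k < CARD('n)"
    and less: "(newton_T k A *v x) \<bullet> x < minor_sum (Suc k) A"
  shows "A - outer x x \<in> garding_cone (Suc k)"
proof -
  let ?T = "(\<lambda>s. A + (- s) *\<^sub>R outer x x) ` {0..1}"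
  have "minor_sum (Suc k) (A + (- s) *\<^sub>R outer x x) > 0" if "s \<in> {0..1}" for s
  proof -
    have "s * ((newton_T k A *v x) \<bullet> x) \<le> 1 * ((newton_T k A *v x) \<bullet> x)"
      using that newton_T_nonneg[OF A_cone k_less_card] by (intro mult_right_mono) auto
    then show ?thesis
      using less
      by (simp only: minor_sum_add_scaleR_outer_self[OF garding_cone_symmetric[OF A_cone] k_less_card])
  qed
  then have "?T \<subseteq> {B. transpose B = B \<and> minor_sum (Suc k) B > 0}"
    using garding_cone_symmetric[OF A_cone]
    by (auto simp: transpose_diff transpose_scalar transpose_outer_self)
  moreover have "connected ?T"
    by (intro connected_continuous_image continuous_intros) simp
  moreover have "A \<in> ?T" by (rule image_eqI[of _ _ 0]) auto
  ultimately have "?T \<subseteq> garding_cone (Suc k)"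
    using A_cone k_less_card by (intro connected_subset_garding_cone) auto
  moreover have "A - outer x x \<in> ?T" by (rule image_eqI[of _ _ 1]) auto
  ultimately show ?thesis by blast
qed

section \<open>Superadditivity and concavity\<close>

lemma mahler_inequality:
  fixes c d :: "'i \<Rightarrow> real"
  assumes index_set: "finite S" "S \<noteq> {}" and nonneg: "\<And>i. i \<in> S \<Longrightarrow> c i \<ge> 0" "\<And>i. i \<in> S \<Longrightarrow> d i \<ge> 0"
  shows "(\<Prod>i\<in>S. c i) powr (1 / card S) + (\<Prod>i\<in>S. d i) powr (1 / card S) \<le>
    (\<Prod>i\<in>S. c i + d i) powr (1 / card S)"
proof (cases "\<exists>i\<in>S. c i + d i = 0")
  case True
  then have "\<exists>i\<in>S. c i = 0 \<and> d i = 0" using nonneg by (meson add_nonneg_eq_0_iff)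
  then have "(\<Prod>i\<in>S. c i) = 0" "(\<Prod>i\<in>S. d i) = 0" using index_set(1) by auto
  then show ?thesis by simp
next
  case False
  let ?n = "real (card S)" and ?P = "\<Prod>i\<in>S. c i + d i"
  have sum_pos: "c i + d i > 0" if "i \<in> S" for i
    using False nonneg that by (metis add_nonneg_nonneg order_le_less)
  then have P_pos: "?P > 0" by (intro prod_pos) auto
  have quotient: "(\<Prod>i\<in>S. f i / (c i + d i)) powr (1 / ?n) = (\<Prod>i\<in>S. f i) powr (1 / ?n) / ?P powr (1 / ?n)"
    if "\<And>i. i \<in> S \<Longrightarrow> f i \<ge> 0" for f
    using P_pos that by (simp add: prod_dividef powr_divide prod_nonneg)
  have "(\<Prod>i\<in>S. c i / (c i + d i)) powr (1 / ?n) + (\<Prod>i\<in>S. d i / (c i + d i)) powr (1 / ?n) \<le>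
      (\<Sum>i\<in>S. c i / (c i + d i) / ?n) + (\<Sum>i\<in>S. d i / (c i + d i) / ?n)"
    using nonneg
    by (intro add_mono arith_geom_mean index_set divide_nonneg_nonneg add_nonneg_nonneg) auto
  also have "\<dots> = (\<Sum>i\<in>S. 1 / ?n)"
    unfolding sum.distrib[symmetric] add_divide_distrib[symmetric]
    using sum_pos by (intro sum.cong refl) force
  also have "\<dots> = 1" using index_set by simp
  finally show ?thesis
    using P_pos by (simp add: quotient nonneg add_divide_distrib[symmetric])
qed

lemma garding_cone_minkowski_inequality:
  fixes A B :: "real^'n^'n"
  assumes A_cone: "A \<in> garding_cone k" and B_cone: "B \<in> garding_cone k"
    and k_le_card: "k \<le> CARD('n)" and a_pos: "a > 0" and b_pos: "b > 0"
  shows "(a * minor_sum k A) powr (1 / (real k + 1)) + (b * minor_sum k B) powr (1 / (real k + 1)) \<le>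
    ((a + b) * minor_sum k (A + B)) powr (1 / (real k + 1))"
proof -
  let ?p = "1 / (real k + 1)"
  obtain c where pencil_factors: "\<And>i. i < k \<Longrightarrow> c i > 0"
    "\<And>s. minor_sum k (A + s *\<^sub>R B) = minor_sum k B * (\<Prod>i<k. s + c i)"
    using garding_cone_pencil_factorization[OF A_cone B_cone k_le_card] by blast
  define \<alpha> where "\<alpha> i = (if i < k then c i else a)" for i
  define \<beta> where "\<beta> i = (if i < k then 1 else b)" for i
  have nonneg: "\<alpha> i \<ge> 0" "\<beta> i \<ge> 0" for i
    using a_pos b_pos pencil_factors(1) by (auto simp: \<alpha>_def \<beta>_def less_imp_le)
  have B_nonneg: "minor_sum k B \<ge> 0" using garding_cone_minor_sum_pos[OF B_cone order_refl] by simp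
  have factors: "a * minor_sum k A = minor_sum k B * (\<Prod>i<Suc k. \<alpha> i)"
    "b * minor_sum k B = minor_sum k B * (\<Prod>i<Suc k. \<beta> i)"
    "(a + b) * minor_sum k (A + B) = minor_sum k B * (\<Prod>i<Suc k. \<alpha> i + \<beta> i)"
    using pencil_factors(2)[of 0] pencil_factors(2)[of 1] by (simp_all add: \<alpha>_def \<beta>_def add.commute)
  have "(minor_sum k B * (\<Prod>i<Suc k. \<alpha> i)) powr ?p + (minor_sum k B * (\<Prod>i<Suc k. \<beta> i)) powr ?p =
      minor_sum k B powr ?p * ((\<Prod>i<Suc k. \<alpha> i) powr ?p + (\<Prod>i<Suc k. \<beta> i) powr ?p)"
    using B_nonneg nonneg by (simp add: powr_mult prod_nonneg distrib_left del: prod.lessThan_Suc)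
  also have "\<dots> \<le> minor_sum k B powr ?p * (\<Prod>i<Suc k. \<alpha> i + \<beta> i) powr ?p"
    using mahler_inequality[of "{..<Suc k}" \<alpha> \<beta>] nonneg
    by (intro mult_left_mono) (simp_all add: add.commute lessThan_empty_iff del: prod.lessThan_Suc)
  also have "\<dots> = (minor_sum k B * (\<Prod>i<Suc k. \<alpha> i + \<beta> i)) powr ?p"
    using B_nonneg nonneg by (simp add: powr_mult prod_nonneg del: prod.lessThan_Suc)
  finally show ?thesis unfolding factors .
qed

lemma concave_on_if_superadditive_homogeneous:
  fixes f :: "'a::real_vector \<Rightarrow> real"
  assumes add: "\<And>x y. x \<in> S \<Longrightarrow> y \<in> S \<Longrightarrow> x + y \<in> S \<and> f x + f y \<le> f (x + y)"
    and scale: "\<And>x t. x \<in> S \<Longrightarrow> t > 0 \<Longrightarrow> t *\<^sub>R x \<in> S \<and> f (t *\<^sub>R x) = t * f x"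
  shows "concave_on S f"
proof -
  have "u *\<^sub>R x + v *\<^sub>R y \<in> S \<and> u * f x + v * f y \<le> f (u *\<^sub>R x + v *\<^sub>R y)"
    if "x \<in> S" "y \<in> S" "u \<ge> 0" "v \<ge> 0" "u + v = 1" for x y u v
  proof (cases "u = 0 \<or> v = 0")
    case False
    then show ?thesis using that scale[of x u] scale[of y v] add[of "u *\<^sub>R x" "v *\<^sub>R y"] by simp
  qed (use that in auto)
  then show ?thesis by (simp add: concave_on_iff convex_def)
qed

lemma concave_on_ln_if_concave_on_powr:
  fixes f :: "'a::real_vector \<Rightarrow> real"
  assumes concave: "concave_on S (\<lambda>x. f x powr p)" and p_pos: "p > 0" and f_pos: "\<And>x. x \<in> S \<Longrightarrow> f x > 0"
  shows "concave_on S (\<lambda>x. ln (f x))"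
proof -
  have convex_S: "convex S" by (rule concave_on_imp_convex[OF concave])
  have "u * ln (f x) + v * ln (f y) \<le> ln (f (u *\<^sub>R x + v *\<^sub>R y))"
    if points: "x \<in> S" "y \<in> S" and weights: "u \<ge> 0" "v \<ge> 0" "u + v = 1" for x y u v
  proof -
    have combination_pos: "f (u *\<^sub>R x + v *\<^sub>R y) > 0"
      using convex_S points weights by (intro f_pos) (simp add: convex_def)
    have powr_pos: "f x powr p \<in> {0<..}" "f y powr p \<in> {0<..}"
      using f_pos points by (auto simp: less_le)
    have "p * (u * ln (f x) + v * ln (f y)) = u * ln (f x powr p) + v * ln (f y powr p)"
      by (simp add: ln_powr algebra_simps)
    also have "\<dots> \<le> ln (u *\<^sub>R f x powr p + v *\<^sub>R f y powr p)"
      using ln_concave powr_pos weights unfolding concave_on_iff by blast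
    also have "\<dots> \<le> ln (f (u *\<^sub>R x + v *\<^sub>R y) powr p)"
    proof (rule ln_mono)
      have "convex {0::real<..}" by simp
      then show "0 < u *\<^sub>R f x powr p + v *\<^sub>R f y powr p"
        using powr_pos weights unfolding convex_def by blast
      show "u *\<^sub>R f x powr p + v *\<^sub>R f y powr p \<le> f (u *\<^sub>R x + v *\<^sub>R y) powr p"
        using concave points weights by (simp add: concave_on_iff)
    qed
    also have "\<dots> = p * ln (f (u *\<^sub>R x + v *\<^sub>R y))"
      by (simp add: ln_powr)
    finally show ?thesis using p_pos by simp
  qed
  with convex_S show ?thesis by (simp add: concave_on_iff)
qed

section \<open>Schur complements\<close>

definition schur_complement :: "real^('n::finite option)^('n option) \<Rightarrow> real^'n^'n" where
  "schur_complement R = blk_r R - (1 / R $ None $ None) *\<^sub>R outer (blk_x R) (blk_x R)"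

lemma transpose_blk_r: "transpose R = R \<Longrightarrow> transpose (blk_r R) = blk_r R"
  by (simp add: transpose_def blk_r_def vec_eq_iff)

lemma F_Suc_eq_minor_sum:
  fixes R :: "real^('n::finite option)^('n option)"
  assumes "transpose R = R"
  shows "F (Suc k) R = R $ None $ None * minor_sum (Suc k) (blk_r R) -
    (newton_T k (blk_r R) *v blk_x R) \<bullet> blk_x R"
  using sigma_eq_minor_sum[OF transpose_blk_r[OF assms]] by (simp add: F_def inner_commute)

lemma F_eq_schur_complement:
  fixes R :: "real^('n::finite option)^('n option)"
  assumes "transpose R = R" and "k < CARD('n)" and "R $ None $ None \<noteq> 0"
  shows "F (Suc k) R = R $ None $ None * minor_sum (Suc k) (schur_complement R)"
  using assms(3) minor_sum_add_scaleR_outer_self[OF transpose_blk_r[OF assms(1)] assms(2),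
      of "- 1 / R $ None $ None" "blk_x R"]
  by (simp add: F_Suc_eq_minor_sum[OF assms(1)] schur_complement_def field_simps)

lemma schur_complement_eq_diff_outer:
  assumes "R $ None $ None > 0"
  defines "x \<equiv> (1 / sqrt (R $ None $ None)) *\<^sub>R blk_x R"
  shows "schur_complement R = blk_r R - outer x x"
  using assms(1) by (simp add: schur_complement_def x_def outer_scaleR_self power_divide)

lemma schur_complement_scaleR:
  "t \<noteq> 0 \<Longrightarrow> schur_complement (t *\<^sub>R R) = t *\<^sub>R schur_complement R"
  by (simp add: schur_complement_def blk_r_def blk_x_def outer_def vec_eq_iff algebra_simps)

lemma schur_complement_add:
  assumes R_pos: "R $ None $ None > 0" and R'_pos: "R' $ None $ None > 0"
  obtains v where "schur_complement (R + R') = schur_complement R + schur_complement R' + outer v v"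
proof -
  define a where "a = R $ None $ None"
  define b where "b = R' $ None $ None"
  define z where "z = (1 / a) *\<^sub>R blk_x R - (1 / b) *\<^sub>R blk_x R'"
  define h where "h = a * b / (a + b)"
  have "outer (sqrt h *\<^sub>R z) (sqrt h *\<^sub>R z) = h *\<^sub>R outer z z"
    using assms by (simp add: outer_scaleR_self h_def a_def b_def)
  moreover have "schur_complement (R + R') = schur_complement R + schur_complement R' + h *\<^sub>R outer z z"
  proof -
    have "a \<noteq> 0" "b \<noteq> 0" "a + b \<noteq> 0" using assms by (auto simp: a_def b_def)
    then have "(p + p') * (q + q') / (a + b) =
        p * q / a + p' * q' / b - a * b * ((p / a - p' / b) * (q / a - q' / b)) / (a + b)" for p p' q q'
      by (simp add: divide_simps) algebra
    then show ?thesis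
      by (simp add: vec_eq_iff schur_complement_def blk_r_def blk_x_def outer_def z_def h_def
          flip: a_def b_def)
  qed
  ultimately show ?thesis by (intro that[of "sqrt h *\<^sub>R z"]) simp
qed

lemma mem_S_set_iff_schur_complement:
  fixes R :: "real^('n::finite option)^('n option)"
  assumes k_less_card: "k < CARD('n)"
  shows "R \<in> S_set (Suc k) \<longleftrightarrow>
    transpose R = R \<and> R $ None $ None > 0 \<and> schur_complement R \<in> garding_cone (Suc k)"
proof (cases "transpose R = R")
  case sym: True
  define a where "a = R $ None $ None"
  let ?r = "blk_r R" and ?x = "(1 / sqrt a) *\<^sub>R blk_x R"
  have "a > 0 \<and> schur_complement R \<in> garding_cone (Suc k)"
    if r_cone: "?r \<in> garding_cone (Suc k)" and F_pos: "F (Suc k) R > 0"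
  proof
    have "a * minor_sum (Suc k) ?r > 0"
      using F_pos newton_T_nonneg[OF r_cone k_less_card, of "blk_x R"]
      by (simp add: F_Suc_eq_minor_sum[OF sym] a_def)
    then show a_pos: "a > 0"
      using garding_cone_minor_sum_pos[OF r_cone order_refl] by (simp add: zero_less_mult_iff)
    have "(newton_T k ?r *v ?x) \<bullet> ?x = (newton_T k ?r *v blk_x R) \<bullet> blk_x R / a"
      using a_pos by (simp add: matrix_vector_mult_scaleR)
    also have "\<dots> < minor_sum (Suc k) ?r"
      using F_pos a_pos by (simp add: F_Suc_eq_minor_sum[OF sym] a_def field_simps)
    finally show "schur_complement R \<in> garding_cone (Suc k)"
      using garding_cone_diff_outer[OF r_cone k_less_card] schur_complement_eq_diff_outer[of R] a_pos
      by (simp add: a_def)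
  qed
  moreover have "?r \<in> garding_cone (Suc k) \<and> F (Suc k) R > 0"
    if a_pos: "a > 0" and schur_cone: "schur_complement R \<in> garding_cone (Suc k)"
  proof
    show "?r \<in> garding_cone (Suc k)"
      using garding_cone_add_outer[OF schur_cone, of ?x] k_less_card a_pos
      by (simp add: schur_complement_eq_diff_outer a_def)
    show "F (Suc k) R > 0"
      using garding_cone_minor_sum_pos[OF schur_cone order_refl] a_pos
      by (simp add: F_eq_schur_complement[OF sym k_less_card] a_def)
  qed
  ultimately show ?thesis
    using sym by (auto simp: S_set_def Gamma_plus_iff_garding_cone transpose_blk_r a_def)
qed (simp add: S_set_def)

lemma S_set_scaleR:
  fixes R :: "real^('n::finite option)^('n option)"
  assumes k_less_card: "k < CARD('n)" and R_mem: "R \<in> S_set (Suc k)" and t_pos: "t > 0"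
  defines "p \<equiv> 1 / (real (Suc k) + 1)"
  shows "t *\<^sub>R R \<in> S_set (Suc k)"
    and "F (Suc k) (t *\<^sub>R R) powr p = t * F (Suc k) R powr p"
proof -
  have R_props: "transpose R = R" "R $ None $ None > 0" "schur_complement R \<in> garding_cone (Suc k)"
    using R_mem by (auto simp: mem_S_set_iff_schur_complement[OF k_less_card])
  have sym: "transpose (t *\<^sub>R R) = t *\<^sub>R R" using R_props(1) by (simp add: transpose_scalar)
  then show "t *\<^sub>R R \<in> S_set (Suc k)"
    using R_props t_pos
    by (simp add: mem_S_set_iff_schur_complement[OF k_less_card] schur_complement_scaleR
        garding_cone_scaleR)
  have "F (Suc k) (t *\<^sub>R R) = t ^ (k + 2) * F (Suc k) R"
    using R_props sym t_pos
    by (simp add: F_eq_schur_complement[OF _ k_less_card] schur_complement_scaleR minor_sum_scaleR)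
  also have "t ^ (k + 2) = t powr (real (Suc k) + 1)"
    using powr_realpow[OF t_pos, of "k + 2"] by (simp add: add.commute)
  finally show "F (Suc k) (t *\<^sub>R R) powr p = t * F (Suc k) R powr p"
    using t_pos R_mem by (simp add: p_def powr_mult powr_powr S_set_def)
qed

lemma S_set_add:
  fixes R R' :: "real^('n::finite option)^('n option)"
  assumes k_less_card: "k < CARD('n)" and R_mem: "R \<in> S_set (Suc k)" and R'_mem: "R' \<in> S_set (Suc k)"
  defines "p \<equiv> 1 / (real (Suc k) + 1)"
  shows "R + R' \<in> S_set (Suc k)"
    and "F (Suc k) R powr p + F (Suc k) R' powr p \<le> F (Suc k) (R + R') powr p"
proof -
  define a where "a = R $ None $ None"
  define b where "b = R' $ None $ None"
  define A where "A = schur_complement R"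
  define B where "B = schur_complement R'"
  have sym: "transpose R = R" "transpose R' = R'" "transpose (R + R') = R + R'"
    and a_pos: "a > 0" and b_pos: "b > 0"
    and A_cone: "A \<in> garding_cone (Suc k)" and B_cone: "B \<in> garding_cone (Suc k)"
    using R_mem R'_mem
    by (auto simp: mem_S_set_iff_schur_complement[OF k_less_card] transpose_add a_def b_def A_def B_def)
  obtain v where schur_sum: "schur_complement (R + R') = A + B + outer v v"
    unfolding A_def B_def using schur_complement_add a_pos b_pos unfolding a_def b_def by blast
  have Suc_k_le_card: "Suc k \<le> CARD('n)" using k_less_card by simp
  have sum_cone: "A + B \<in> garding_cone (Suc k)"
    by (rule garding_cone_add[OF A_cone B_cone Suc_k_le_card])
  show "R + R' \<in> S_set (Suc k)"
    using sym(3) a_pos b_pos garding_cone_add_outer[OF sum_cone Suc_k_le_card, of v]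
    by (simp add: mem_S_set_iff_schur_complement[OF k_less_card] schur_sum a_def b_def)
  have F_eqs: "F (Suc k) R = a * minor_sum (Suc k) A" "F (Suc k) R' = b * minor_sum (Suc k) B"
    "F (Suc k) (R + R') = (a + b) * minor_sum (Suc k) (A + B + outer v v)"
    using F_eq_schur_complement[OF sym(1) k_less_card] F_eq_schur_complement[OF sym(2) k_less_card]
      F_eq_schur_complement[OF sym(3) k_less_card] a_pos b_pos
    by (simp_all add: schur_sum a_def b_def A_def B_def)
  have "F (Suc k) R powr p + F (Suc k) R' powr p \<le> ((a + b) * minor_sum (Suc k) (A + B)) powr p"
    unfolding F_eqs p_def by (rule garding_cone_minkowski_inequality[OF A_cone B_cone Suc_k_le_card a_pos b_pos])
  also have "\<dots> \<le> F (Suc k) (R + R') powr p"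
    unfolding F_eqs
    using minor_sum_add_outer_ge[OF sum_cone k_less_card] a_pos b_pos
      garding_cone_minor_sum_pos[OF sum_cone order_refl]
    by (intro powr_mono2 mult_left_mono) (auto simp: p_def)
  finally show "F (Suc k) R powr p + F (Suc k) R' powr p \<le> F (Suc k) (R + R') powr p" .
qed

theorem theorem2p1:
  fixes k :: nat
  assumes "1 \<le> k" and "k \<le> CARD('n::finite)"
  shows "convex (S_set k :: (real^('n option)^('n option)) set)
    \<and> (\<forall>R \<in> (S_set k :: (real^('n option)^('n option)) set). \<forall>t::real. t > 0 \<longrightarrow> t *\<^sub>R R \<in> S_set k)
    \<and> concave_on (S_set k :: (real^('n option)^('n option)) set) (\<lambda>R. F k R powr (1 / (real k + 1)))
    \<and> concave_on (S_set k :: (real^('n option)^('n option)) set) (\<lambda>R. ln (F k R))"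
proof -
  let ?S = "S_set k :: (real^('n option)^('n option)) set" and ?p = "1 / (real k + 1)"
  obtain m where k_eq: "k = Suc m" "m < CARD('n)" using assms by (cases k) auto
  have scale: "t *\<^sub>R R \<in> ?S \<and> F k (t *\<^sub>R R) powr ?p = t * F k R powr ?p" if "R \<in> ?S" "t > 0" for R t
    using S_set_scaleR[OF k_eq(2)] that by (simp add: k_eq(1))
  have root: "concave_on ?S (\<lambda>R. F k R powr ?p)"
    using S_set_add[OF k_eq(2)] scale
    by (intro concave_on_if_superadditive_homogeneous) (auto simp: k_eq(1))
  moreover have "concave_on ?S (\<lambda>R. ln (F k R))"
    by (rule concave_on_ln_if_concave_on_powr[OF root]) (auto simp: S_set_def)
  ultimately show ?thesis using scale concave_on_imp_convex by blast
qed

end
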